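(* Let $A$ be a second countable compact Hausdorff space and $H$ a separable Hilbert space. If $E,F\in Q(A;H)$, then $\rho(E,F)=\|\phi_E-\phi_F\|$, where $\|\cdot\|$ is the operator norm of linear maps $C(A)\to\mathcal{B}(H)$.
   Context: $\mathfrak{A}_A$ denotes the Borel $\sigma$-algebra of $A$, $C(A)$ the C*-algebra of continuous complex functions on $A$ with the supremum norm, and $\mathcal{B}(H)$ the bounded operators on $H$. $Q(A;H)$ is the set of $\mathcal{B}(H)$-valued quantum probability measures on $A$: maps $E:\mathfrak{A}_A\to\mathcal{B}(H)$ such that $E(\delta)\ge 0$ for all $\delta\in\mathfrak{A}_A$, $E(\emptyset)=0$, $E(A)=I$, and $E(\bigcup_n\delta_n)=\sum_n E(\delta_n)$ in the strong operator topology for every countable family of pairwise disjoint $\delta_n\in\mathfrak{A}_A$. For $\xi,\eta\in H$, $E_{\xi,\eta}$ is the complex Borel measure $E_{\xi,\eta}(\alpha)=\langle E(\alpha)\xi,\eta\rangle$. The map $\phi_E:C(A)\to\mathcal{B}(H)$ is the unital completely positive map determined by $\langle\phi_E(f)\xi,\eta\rangle=\int_A f\,dE_{\xi,\eta}$ for $f\in C(A)$, $\xi,\eta\in H$. For a complex Borel measure $\mu$ on $A$, $\|\mu\|_{tv}=\sup\{\sum_{i=1}^n|\mu(\alpha_i)|\}$ over all finite Borel partitions $\{\alpha_i\}_{i=1}^n$ of $A$. Finally, $$\rho(E,F)=\sup\{\|E_{\xi,\eta}-F_{\xi,\eta}\|_{tv}:\xi,\eta\in H,\ \|\xi\|=\|\eta\|=1\}.$$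 *)

theory Defs
  imports "HOL-Analysis.Analysis"
begin

section \<open>Complex Hilbert spaces\<close>

class complex_vector = real_vector +
  fixes scaleC :: "complex \<Rightarrow> 'a \<Rightarrow> 'a"  (infixr \<open>*\<^sub>C\<close> 75)
  assumes scaleC_add_right: "c *\<^sub>C (x + y) = c *\<^sub>C x + c *\<^sub>C y"
    and scaleC_add_left: "(c + d) *\<^sub>C x = c *\<^sub>C x + d *\<^sub>C x"
    and scaleC_scaleC: "c *\<^sub>C d *\<^sub>C x = (c * d) *\<^sub>C x"
    and scaleC_one: "1 *\<^sub>C x = x"
    and scaleR_scaleC: "r *\<^sub>R x = complex_of_real r *\<^sub>C x"

text \<open>The inner product is linear in the first argument and conjugate linear in the second.\<close>

class complex_inner = complex_vector + real_normed_vector +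
  fixes cinner :: "'a \<Rightarrow> 'a \<Rightarrow> complex"
  assumes cinner_commute: "cinner x y = cnj (cinner y x)"
    and cinner_add_left: "cinner (x + y) z = cinner x z + cinner y z"
    and cinner_scaleC_left: "cinner (c *\<^sub>C x) y = c * cinner x y"
    and cinner_ge_zero: "0 \<le> Re (cinner x x)"
    and cinner_eq_zero_iff: "cinner x x = 0 \<longleftrightarrow> x = 0"
    and norm_eq_sqrt_cinner: "norm x = sqrt (Re (cinner x x))"

class complex_hilbert = complex_inner + complete_space

text \<open>
  The library type of bounded operators only demands real linearity, so the bounded operators
  on a complex Hilbert space are its complex linear elements.  The operator norm is the same.
\<close>

definition bounded_ops :: "('h::complex_hilbert \<Rightarrow>\<^sub>L 'h) set" where
  "bounded_ops = {T :: 'h \<Rightarrow>\<^sub>L 'h. \<forall>c x. T (c *\<^sub>C x) = c *\<^sub>C T x}"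

definition positive_op :: "('h::complex_hilbert \<Rightarrow>\<^sub>L 'h) \<Rightarrow> bool" where
  "positive_op T \<longleftrightarrow> T \<in> bounded_ops \<and> (\<forall>\<xi>. cinner (T \<xi>) \<xi> \<in> \<real>\<^sub>\<ge>\<^sub>0)"


section \<open>Complex Borel measures\<close>

definition tv_norm :: "('a::topological_space set \<Rightarrow> complex) \<Rightarrow> ennreal" where
  "tv_norm \<mu> = (SUP P \<in> {P. finite P \<and> partition_on UNIV P \<and> P \<subseteq> sets borel}.
                   \<Sum>\<alpha>\<in>P. ennreal (cmod (\<mu> \<alpha>)))"

text \<open>
  For a signed Borel measure \<open>\<nu>\<close>, \<open>upper_variation \<nu>\<close> and \<open>upper_variation (- \<nu>)\<close> are the positive
  and negative parts of its Jordan decomposition.  Note that \<open>ennreal\<close> maps negative reals to \<open>0\<close>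
  and that \<open>\<beta>\<close> may be empty.
\<close>

definition upper_variation :: "('a::topological_space set \<Rightarrow> real) \<Rightarrow> 'a measure" where
  "upper_variation \<nu> =
     measure_of UNIV (sets borel) (\<lambda>\<alpha>. SUP \<beta> \<in> {\<beta> \<in> sets borel. \<beta> \<subseteq> \<alpha>}. ennreal (\<nu> \<beta>))"

definition signed_integral :: "('a::topological_space set \<Rightarrow> real) \<Rightarrow> ('a \<Rightarrow> complex) \<Rightarrow> complex" where
  "signed_integral \<nu> f =
     integral\<^sup>L (upper_variation \<nu>) f - integral\<^sup>L (upper_variation (\<lambda>\<alpha>. - \<nu> \<alpha>)) f"

definition complex_measure_integral ::
    "('a::topological_space set \<Rightarrow> complex) \<Rightarrow> ('a \<Rightarrow> complex) \<Rightarrow> complex" where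
  "complex_measure_integral \<mu> f =
     signed_integral (\<lambda>\<alpha>. Re (\<mu> \<alpha>)) f + \<i> * signed_integral (\<lambda>\<alpha>. Im (\<mu> \<alpha>)) f"


section \<open>Quantum probability measures\<close>

text \<open>
  The values of \<open>E\<close> outside the Borel \<open>\<sigma>\<close>-algebra are irrelevant.  Countable additivity in the
  strong operator topology is convergence at every vector; finite families are covered by
  padding with the empty set.
\<close>

definition quantum_prob_measures ::
    "('a::topological_space set \<Rightarrow> ('h::complex_hilbert \<Rightarrow>\<^sub>L 'h)) set" where
  "quantum_prob_measures =
     {E. (\<forall>\<delta>\<in>sets borel. positive_op (E \<delta>)) \<and>
         E {} = 0 \<and>
         E UNIV = id_blinfun \<and>
         (\<forall>D::nat \<Rightarrow> 'a set. range D \<subseteq> sets borel \<longrightarrow> disjoint_family D \<longrightarrow>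
            (\<forall>\<xi>. (\<lambda>n. E (D n) \<xi>) sums E (\<Union>n. D n) \<xi>))}"

definition qmeasure ::
    "('a::topological_space set \<Rightarrow> ('h::complex_hilbert \<Rightarrow>\<^sub>L 'h)) \<Rightarrow> 'h \<Rightarrow> 'h \<Rightarrow> 'a set \<Rightarrow> complex" where
  "qmeasure E \<xi> \<eta> \<alpha> = cinner (E \<alpha> \<xi>) \<eta>"

text \<open>
  On a compact space, \<open>('a, complex) bcontfun\<close> is the space of all continuous complex functions
  with the supremum norm.
\<close>

definition phi ::
    "('a::topological_space set \<Rightarrow> ('h::complex_hilbert \<Rightarrow>\<^sub>L 'h)) \<Rightarrow> ('a, complex) bcontfun \<Rightarrow> ('h \<Rightarrow>\<^sub>L 'h)" where
  "phi E f = (THE T. T \<in> bounded_ops \<and>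
     (\<forall>\<xi> \<eta>. cinner (T \<xi>) \<eta> = complex_measure_integral (qmeasure E \<xi> \<eta>) (apply_bcontfun f)))"

text \<open>Taking the supremum in \<open>ennreal\<close> makes it \<open>0\<close>, not unspecified, when \<open>H = {0}\<close>.\<close>

definition rho ::
    "('a::topological_space set \<Rightarrow> ('h::complex_hilbert \<Rightarrow>\<^sub>L 'h)) \<Rightarrow>
     ('a set \<Rightarrow> ('h \<Rightarrow>\<^sub>L 'h)) \<Rightarrow> ennreal" where
  "rho E F = (SUP (\<xi>, \<eta>) \<in> {(\<xi>, \<eta>). norm \<xi> = 1 \<and> norm \<eta> = 1}.
                tv_norm (\<lambda>\<alpha>. qmeasure E \<xi> \<eta> \<alpha> - qmeasure F \<xi> \<eta> \<alpha>))"

end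

theory Submission
  imports Defs
begin

text \<open>
  Fix unit vectors \<open>\<xi>\<close>, \<open>\<eta>\<close> and let \<open>\<mu> = E\<^sub>\<xi>\<^sub>\<eta> - F\<^sub>\<xi>\<^sub>\<eta>\<close>.  By the defining property of
  \<open>phi\<close>, the matrix coefficient of \<open>phi E f - phi F f\<close> at \<open>\<xi>\<close>, \<open>\<eta>\<close> is \<open>\<integral> f d\<mu>\<close>.  The norm of an
  operator is the supremum of its matrix coefficients at unit vectors, so both sides of the claim
  are suprema over \<open>\<xi>\<close> and \<open>\<eta>\<close>, and it suffices that for each such \<open>\<mu>\<close> the total variation is the
  supremum of \<open>\<bar>\<integral> f d\<mu>\<bar>\<close> over continuous \<open>f\<close> with \<open>\<bar>f\<bar> \<le> 1\<close>.

  One half of this, \<open>norm_integral_le_tv_norm\<close>, follows by Riemann sums.  The other half,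
  \<open>tv_norm_le_if_integrals_le\<close>, is the isometry in the Riesz representation theorem.  Given a finite
  Borel partition and angles \<open>\<theta>\<^sub>\<alpha>\<close> that rotate the values \<open>\<mu> \<alpha>\<close> to their moduli, it takes continuous
  functions \<open>g\<^sub>\<alpha>\<close> close to the indicators of the pieces in the mean and tests \<open>\<mu>\<close> against
  \<open>exp (\<i> \<Sum> \<theta>\<^sub>\<alpha> g\<^sub>\<alpha>)\<close>.  The functions \<open>g\<^sub>\<alpha>\<close> are provided by \<open>borel_indicator_L1_approx\<close>, which rests
  on Urysohn's lemma and on the fact that open sets of a second countable compact Hausdorff space
  are countable unions of closed sets.

  Before this can be used, the definitions of integral and of \<open>phi\<close> have to be shown meaningful.
  The upper and lower variations are finite measures whose difference is the given signed measure
  (\<open>emeasure_upper_variation\<close>, \<open>jordan_decomposition\<close>), so integrals are approximated by Riemann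
  sums, with an error controlled by a bound for \<open>\<bar>\<mu> \<alpha>\<bar>\<close> alone (\<open>riemann_sum_estimate\<close>).  The
  Cauchy-Schwarz inequality for the positive operators \<open>E \<alpha> \<le> I\<close> supplies the bound
  \<open>norm \<xi> * norm \<eta>\<close> for \<open>E\<^sub>\<xi>\<^sub>\<eta>\<close>; because it is uniform in \<open>\<eta>\<close>, the operator-valued Riemann sums
  converge at each vector and their limit is \<open>phi E f\<close> (\<open>phi_exists\<close>).
\<close>

section \<open>Bounded vector measures and their Jordan decomposition\<close>

locale vector_measure =
  fixes \<mu> :: "'a::topological_space set \<Rightarrow> 'b::real_normed_vector"
  assumes sums_UN: "\<And>D. range D \<subseteq> sets borel \<Longrightarrow> disjoint_family D \<Longrightarrow>
                      (\<lambda>n::nat. \<mu> (D n)) sums \<mu> (\<Union>n. D n)"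
begin

lemma empty: "\<mu> {} = 0"
proof -
  have "(\<lambda>n::nat. \<mu> {}) sums \<mu> {}"
    using sums_UN[of "\<lambda>_. {}"] by (simp add: disjoint_family_on_def)
  then show ?thesis
    using sums_summable summable_const_iff by blast
qed

lemma Un:
  assumes "\<alpha> \<in> sets borel" "\<beta> \<in> sets borel" "\<alpha> \<inter> \<beta> = {}"
  shows "\<mu> (\<alpha> \<union> \<beta>) = \<mu> \<alpha> + \<mu> \<beta>"
proof -
  have "(\<lambda>n. \<mu> (binaryset \<alpha> \<beta> n)) sums \<mu> (\<alpha> \<union> \<beta>)"
    unfolding UN_binaryset_eq[of \<alpha> \<beta>, symmetric]
    using assms by (intro sums_UN) (auto simp: range_binaryset_eq disjoint_family_on_def binaryset_def)
  moreover have "(\<lambda>n. \<mu> (binaryset \<alpha> \<beta> n)) sums (\<mu> \<alpha> + \<mu> \<beta>)"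
    by (rule binaryset_sums) (fact empty)
  ultimately show ?thesis
    by (rule sums_unique2)
qed

lemma Diff:
  assumes "\<alpha> \<in> sets borel" "\<beta> \<in> sets borel" "\<beta> \<subseteq> \<alpha>"
  shows "\<mu> (\<alpha> - \<beta>) = \<mu> \<alpha> - \<mu> \<beta>"
  using Un[of "\<alpha> - \<beta>" \<beta>] assms by (simp add: Un_absorb2 Int_commute)

end

locale bounded_vector_measure = vector_measure \<mu>
  for \<mu> :: "'a::topological_space set \<Rightarrow> 'b::real_normed_vector" +
  fixes K :: real
  assumes norm_le: "\<And>\<alpha>. \<alpha> \<in> sets borel \<Longrightarrow> norm (\<mu> \<alpha>) \<le> K"
begin

lemma bound_nonneg: "0 \<le> K"
  using norm_le[of "{}"] by (simp add: empty)

lemma bounded_linear_image: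
  assumes "bounded_linear h" "\<And>x. norm (h x) \<le> norm x"
  shows "bounded_vector_measure (\<lambda>\<alpha>. h (\<mu> \<alpha>)) K"
proof
  show "(\<lambda>n::nat. h (\<mu> (D n))) sums h (\<mu> (\<Union>n. D n))"
    if "range D \<subseteq> sets borel" "disjoint_family D" for D
    using bounded_linear.sums[OF assms(1) sums_UN[OF that]] .
  show "norm (h (\<mu> \<alpha>)) \<le> K" if "\<alpha> \<in> sets borel" for \<alpha>
    using assms(2) norm_le[OF that] order_trans by blast
qed

end

lemma bounded_vector_measure_diff:
  assumes "bounded_vector_measure \<mu> K" "bounded_vector_measure \<nu> L"
  shows "bounded_vector_measure (\<lambda>\<alpha>. \<mu> \<alpha> - \<nu> \<alpha>) (K + L)"
proof
  interpret m: bounded_vector_measure \<mu> K by fact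
  interpret n: bounded_vector_measure \<nu> L by fact
  show "(\<lambda>n::nat. \<mu> (D n) - \<nu> (D n)) sums (\<mu> (\<Union>n. D n) - \<nu> (\<Union>n. D n))"
    if "range D \<subseteq> sets borel" "disjoint_family D" for D
    using that by (intro sums_diff m.sums_UN n.sums_UN)
  show "norm (\<mu> \<alpha> - \<nu> \<alpha>) \<le> K + L" if "\<alpha> \<in> sets borel" for \<alpha>
    using norm_triangle_ineq4[of "\<mu> \<alpha>" "\<nu> \<alpha>"] m.norm_le[OF that] n.norm_le[OF that] by linarith
qed

lemma sets_upper_variation [simp, measurable_cong]: "sets (upper_variation \<nu>) = sets borel"
  unfolding upper_variation_def
  using sets.sigma_sets_eq[of borel] by (simp add: sets.space_closed)

lemma space_upper_variation [simp]: "space (upper_variation \<nu>) = UNIV"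
  using sets_eq_imp_space_eq[OF sets_upper_variation] by simp

text \<open>
  What has to be shown is that the supremum is countably additive in \<open>\<alpha>\<close>.  Subsets of disjoint
  sets unite to a subset of the union, whence superadditivity; a subset of a union is cut into its
  traces, whence subadditivity.
\<close>

lemma emeasure_upper_variation:
  fixes \<nu> :: "'a::topological_space set \<Rightarrow> real"
  assumes "bounded_vector_measure \<nu> K" "\<alpha> \<in> sets borel"
  shows "emeasure (upper_variation \<nu>) \<alpha> = (SUP \<beta> \<in> {\<beta> \<in> sets borel. \<beta> \<subseteq> \<alpha>}. ennreal (\<nu> \<beta>))"
proof -
  interpret bounded_vector_measure \<nu> K by fact
  define u where "u \<alpha> = (SUP \<beta> \<in> {\<beta> \<in> sets borel. \<beta> \<subseteq> \<alpha>}. ennreal (\<nu> \<beta>))" for \<alpha>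
  have upper: "ennreal (\<nu> \<beta>) \<le> u \<alpha>" if "\<beta> \<in> sets borel" "\<beta> \<subseteq> \<alpha>" for \<alpha> \<beta>
    unfolding u_def using that by (intro SUP_upper) auto
  have mono: "u \<alpha> \<le> u \<beta>" if "\<alpha> \<subseteq> \<beta>" for \<alpha> \<beta>
    unfolding u_def using that by (intro SUP_subset_mono) auto
  have u_empty: "u {} = 0"
  proof -
    have "{\<beta> \<in> sets borel. \<beta> \<subseteq> {}} = {{} :: 'a set}" by auto
    then show ?thesis by (simp add: u_def empty)
  qed
  have pair: "ennreal (\<nu> \<beta>) + ennreal (\<nu> \<gamma>) \<le> u (\<alpha> \<union> \<alpha>')"
    if "\<alpha> \<inter> \<alpha>' = {}" "\<beta> \<in> sets borel" "\<gamma> \<in> sets borel" "\<beta> \<subseteq> \<alpha>" "\<gamma> \<subseteq> \<alpha>'" for \<alpha> \<alpha>' \<beta> \<gamma>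
  proof -
    have "\<nu> (\<beta> \<union> \<gamma>) = \<nu> \<beta> + \<nu> \<gamma>"
      using that by (intro Un) auto
    then have "ennreal (\<nu> \<beta> + \<nu> \<gamma>) \<le> u (\<alpha> \<union> \<alpha>')"
      using upper[of "\<beta> \<union> \<gamma>" "\<alpha> \<union> \<alpha>'"] that by auto
    moreover have "ennreal (\<nu> \<beta>) \<le> u (\<alpha> \<union> \<alpha>')" "ennreal (\<nu> \<gamma>) \<le> u (\<alpha> \<union> \<alpha>')"
      using that by (auto intro: upper)
    ultimately show ?thesis
      by (cases "0 \<le> \<nu> \<beta>"; cases "0 \<le> \<nu> \<gamma>") (simp_all add: ennreal_neg)
  qed
  have super: "u \<alpha> + u \<alpha>' \<le> u (\<alpha> \<union> \<alpha>')" if d: "\<alpha> \<inter> \<alpha>' = {}" for \<alpha> \<alpha>'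
  proof -
    have ne: "{\<beta> \<in> sets borel. \<beta> \<subseteq> \<gamma>} \<noteq> {}" for \<gamma> :: "'a set" by auto
    have "ennreal (\<nu> \<beta>) + u \<alpha>' \<le> u (\<alpha> \<union> \<alpha>')" if "\<beta> \<in> sets borel" "\<beta> \<subseteq> \<alpha>" for \<beta>
      unfolding u_def[of \<alpha>'] ennreal_SUP_add_right[OF ne]
      using that d by (intro SUP_least) (auto intro: pair)
    then show ?thesis
      unfolding u_def[of \<alpha>] ennreal_SUP_add_left[OF ne, symmetric]
      by (intro SUP_least) auto
  qed
  have finite_super: "(\<Sum>i<n. u (D i)) \<le> u (\<Union>i<n. D i)" if "disjoint_family D"
    for D :: "nat \<Rightarrow> 'a set" and n
  proof (induction n)
    case (Suc n)
    have "D i \<inter> D n = {}" if "i < n" for i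
      using disjoint_family_onD[OF \<open>disjoint_family D\<close>, of i n] that by simp
    then have "(\<Union>i<n. D i) \<inter> D n = {}"
      by blast
    then have "u (\<Union>i<n. D i) + u (D n) \<le> u (\<Union>i<Suc n. D i)"
      using super[of "\<Union>i<n. D i" "D n"] by (simp add: lessThan_Suc Un_commute)
    then show ?case
      unfolding sum.lessThan_Suc by (rule order_trans[OF add_right_mono[OF Suc.IH]])
  qed (simp add: u_empty)
  have "countably_additive (sets borel) u"
    unfolding countably_additive_def
  proof (intro allI impI antisym)
    fix D :: "nat \<Rightarrow> 'a set"
    assume D: "range D \<subseteq> sets borel" "disjoint_family D"
    show "(\<Sum>i. u (D i)) \<le> u (\<Union>(range D))"
      unfolding suminf_eq_SUP
      by (intro SUP_least order_trans[OF finite_super[OF D(2)]] mono) auto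
    show "u (\<Union>(range D)) \<le> (\<Sum>i. u (D i))"
      unfolding u_def[of "\<Union>(range D)"]
    proof (intro SUP_least, clarify)
      fix \<beta> :: "'a set"
      assume \<beta>: "\<beta> \<in> sets borel" "\<beta> \<subseteq> (\<Union>n. D n)"
      have "(\<lambda>n. \<nu> (\<beta> \<inter> D n)) sums \<nu> (\<Union>n. \<beta> \<inter> D n)"
        using D \<beta> by (intro sums_UN) (auto simp: disjoint_family_on_def)
      moreover have "(\<Union>n. \<beta> \<inter> D n) = \<beta>"
        using \<beta> by auto
      ultimately have "(\<lambda>n. ennreal (\<Sum>i<n. \<nu> (\<beta> \<inter> D i))) \<longlonglongrightarrow> ennreal (\<nu> \<beta>)"
        by (simp add: sums_def tendsto_ennrealI)
      moreover have "ennreal (\<Sum>i<n. \<nu> (\<beta> \<inter> D i)) \<le> (\<Sum>i. u (D i))" for n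
      proof -
        have "(\<Sum>i<n. \<nu> (\<beta> \<inter> D i)) \<le> (\<Sum>i<n. max 0 (\<nu> (\<beta> \<inter> D i)))"
          by (intro sum_mono) auto
        then have "ennreal (\<Sum>i<n. \<nu> (\<beta> \<inter> D i)) \<le> (\<Sum>i<n. ennreal (max 0 (\<nu> (\<beta> \<inter> D i))))"
          by (subst sum_ennreal) (auto intro: ennreal_leI)
        also have "\<dots> \<le> (\<Sum>i<n. u (D i))"
          using D \<beta>(1) by (intro sum_mono) (auto simp: max_def ennreal_neg intro!: upper)
        also have "\<dots> \<le> (\<Sum>i. u (D i))"
          by (intro sum_le_suminf) auto
        finally show ?thesis .
      qed
      ultimately show "ennreal (\<nu> \<beta>) \<le> (\<Sum>i. u (D i))"
        by (intro LIMSEQ_le_const2) auto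
    qed
  qed
  moreover have "positive (sets borel) u"
    by (simp add: positive_def u_empty)
  ultimately have "emeasure (upper_variation \<nu>) \<alpha> = u \<alpha>"
    unfolding upper_variation_def u_def[abs_def]
    using assms(2) sets.sigma_algebra_axioms[of "borel :: 'a measure"]
    by (intro emeasure_measure_of_sigma) auto
  then show ?thesis by (simp add: u_def)
qed

lemma emeasure_upper_variation_le:
  fixes \<nu> :: "'a::topological_space set \<Rightarrow> real"
  assumes "bounded_vector_measure \<nu> K" "\<alpha> \<in> sets borel"
  shows "emeasure (upper_variation \<nu>) \<alpha> \<le> ennreal K"
  unfolding emeasure_upper_variation[OF assms]
  using bounded_vector_measure.norm_le[OF assms(1)]
  by (intro SUP_least ennreal_leI) (auto simp: abs_le_iff)

lemma finite_measure_upper_variation: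
  fixes \<nu> :: "'a::topological_space set \<Rightarrow> real"
  assumes "bounded_vector_measure \<nu> K"
  shows "finite_measure (upper_variation \<nu>)"
  using emeasure_upper_variation_le[OF assms, of UNIV]
  by (intro finite_measureI) (auto simp: top_unique)

lemma measure_upper_variation_le:
  fixes \<nu> :: "'a::topological_space set \<Rightarrow> real"
  assumes "bounded_vector_measure \<nu> K"
  shows "measure (upper_variation \<nu>) UNIV \<le> K"
  using emeasure_upper_variation_le[OF assms, of UNIV] bounded_vector_measure.bound_nonneg[OF assms]
  by (simp add: measure_def enn2real_leI)

text \<open>
  Passing from a Borel subset of \<open>\<alpha>\<close> to its complement in \<open>\<alpha>\<close> turns the supremum defining the
  positive part into \<open>\<nu> \<alpha>\<close> plus the supremum defining the negative part.
\<close>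

lemma jordan_decomposition:
  fixes \<nu> :: "'a::topological_space set \<Rightarrow> real"
  assumes "bounded_vector_measure \<nu> K" "\<alpha> \<in> sets borel"
  shows "\<nu> \<alpha> = measure (upper_variation \<nu>) \<alpha> - measure (upper_variation (\<lambda>\<alpha>. - \<nu> \<alpha>)) \<alpha>"
proof -
  have half: "measure (upper_variation \<kappa>) \<alpha> \<le> \<kappa> \<alpha> + measure (upper_variation (\<lambda>\<alpha>. - \<kappa> \<alpha>)) \<alpha>"
    if \<kappa>: "bounded_vector_measure \<kappa> K" for \<kappa>
  proof -
    interpret bounded_vector_measure \<kappa> K by fact
    have neg: "bounded_vector_measure (\<lambda>\<alpha>. - \<kappa> \<alpha>) K"
      using bounded_linear_image[OF bounded_linear_minus[OF bounded_linear_ident]] by simp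
    interpret N: finite_measure "upper_variation (\<lambda>\<alpha>. - \<kappa> \<alpha>)"
      by (rule finite_measure_upper_variation[OF neg])
    have *: "\<kappa> \<beta> \<le> \<kappa> \<alpha> + measure (upper_variation (\<lambda>\<alpha>. - \<kappa> \<alpha>)) \<alpha>"
      if "\<beta> \<in> sets borel" "\<beta> \<subseteq> \<alpha>" for \<beta>
    proof -
      have "ennreal (- \<kappa> (\<alpha> - \<beta>)) \<le> emeasure (upper_variation (\<lambda>\<alpha>. - \<kappa> \<alpha>)) \<alpha>"
        unfolding emeasure_upper_variation[OF neg assms(2)]
        using that assms(2) by (intro SUP_upper) auto
      then show ?thesis
        using that assms(2) by (simp add: N.emeasure_eq_measure Diff)
    qed
    have "emeasure (upper_variation \<kappa>) \<alpha>
            \<le> ennreal (\<kappa> \<alpha> + measure (upper_variation (\<lambda>\<alpha>. - \<kappa> \<alpha>)) \<alpha>)"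
      unfolding emeasure_upper_variation[OF \<kappa> assms(2)]
      using * by (intro SUP_least ennreal_leI) auto
    moreover have "0 \<le> \<kappa> \<alpha> + measure (upper_variation (\<lambda>\<alpha>. - \<kappa> \<alpha>)) \<alpha>"
      using *[of "{}"] by (simp add: empty)
    ultimately show ?thesis
      by (simp add: measure_def enn2real_leI)
  qed
  interpret bounded_vector_measure \<nu> K by fact
  have "bounded_vector_measure (\<lambda>\<alpha>. - \<nu> \<alpha>) K"
    using bounded_linear_image[OF bounded_linear_minus[OF bounded_linear_ident]] by simp
  from half[OF this] half[OF assms(1)] show ?thesis by simp
qed

section \<open>Integration against a complex measure\<close>

text \<open>
  The four finite measures \<open>jordan_part \<mu> j\<close>, \<open>j < 4\<close>, are the positive parts of
  \<open>Re \<mu>\<close>, \<open>Im \<mu>\<close>, \<open>- Re \<mu>\<close>, \<open>- Im \<mu>\<close>, in this order.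
\<close>

definition jordan_part :: "('a::topological_space set \<Rightarrow> complex) \<Rightarrow> nat \<Rightarrow> 'a measure" where
  "jordan_part \<mu> j = upper_variation (\<lambda>\<alpha>. Re ((- \<i>) ^ j * \<mu> \<alpha>))"

lemma sets_jordan_part [simp, measurable_cong]: "sets (jordan_part \<mu> j) = sets borel"
  by (simp add: jordan_part_def)

lemma space_jordan_part [simp]: "space (jordan_part \<mu> j) = UNIV"
  by (simp add: jordan_part_def)

lemma complex_measure_integral_jordan_part:
  "complex_measure_integral \<mu> f = (\<Sum>j<4. \<i> ^ j * integral\<^sup>L (jordan_part \<mu> j) f)"
  by (simp add: complex_measure_integral_def signed_integral_def jordan_part_def
      eval_nat_numeral lessThan_Suc algebra_simps)

lemma partition_sum_indicator:
  fixes c :: "'a set \<Rightarrow> 'b::semiring_1"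
  assumes "finite P" "partition_on UNIV P" "\<alpha> \<in> P" "x \<in> \<alpha>"
  shows "(\<Sum>\<beta>\<in>P. c \<beta> * indicator \<beta> x) = c \<alpha>"
proof -
  have "x \<notin> \<beta>" if "\<beta> \<in> P" "\<beta> \<noteq> \<alpha>" for \<beta>
    using assms that unfolding partition_on_def disjoint_def by blast
  then have "(\<Sum>\<beta>\<in>P. c \<beta> * indicator \<beta> x) = (\<Sum>\<beta>\<in>{\<alpha>}. c \<beta> * indicator \<beta> x)"
    using assms by (intro sum.mono_neutral_right) auto
  then show ?thesis
    using assms by simp
qed

locale bounded_complex_measure = bounded_vector_measure \<mu> K
  for \<mu> :: "'a::topological_space set \<Rightarrow> complex" and K :: real
begin

lemma jordan_part_bounded: "bounded_vector_measure (\<lambda>\<alpha>. Re ((- \<i>) ^ j * \<mu> \<alpha>)) K"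
proof (rule bounded_linear_image)
  show "bounded_linear (\<lambda>z. Re ((- \<i>) ^ j * z))"
    by (intro bounded_linear_compose[OF bounded_linear_Re] bounded_linear_mult_right)
  show "norm (Re ((- \<i>) ^ j * z)) \<le> norm z" for z
    using abs_Re_le_cmod[of "(- \<i>) ^ j * z"] by (simp add: norm_mult norm_power)
qed

lemma finite_measure_jordan_part: "finite_measure (jordan_part \<mu> j)"
  unfolding jordan_part_def by (rule finite_measure_upper_variation[OF jordan_part_bounded])

lemma measure_jordan_part_le: "measure (jordan_part \<mu> j) UNIV \<le> K"
  unfolding jordan_part_def by (rule measure_upper_variation_le[OF jordan_part_bounded])

lemma eq_sum_jordan_part:
  assumes "\<alpha> \<in> sets borel"
  shows "\<mu> \<alpha> = (\<Sum>j<4. \<i> ^ j * measure (jordan_part \<mu> j) \<alpha>)"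
  using jordan_decomposition[OF jordan_part_bounded[of 0] assms]
    jordan_decomposition[OF jordan_part_bounded[of 1] assms]
  by (intro complex_eqI) (simp_all add: jordan_part_def eval_nat_numeral lessThan_Suc)

lemma integrable_jordan_part:
  fixes f :: "'a \<Rightarrow> 'c::{banach, second_countable_topology}"
  assumes "f \<in> borel_measurable borel" "\<And>x. norm (f x) \<le> B"
  shows "integrable (jordan_part \<mu> j) f"
proof -
  interpret finite_measure "jordan_part \<mu> j" by (rule finite_measure_jordan_part)
  show ?thesis
    using assms by (intro integrable_const_bound[of _ B]) auto
qed

text \<open>
  Both sides of the difference are the same combination of integrals against the Jordan parts,
  of \<open>f\<close> and of the step function with values \<open>c\<close>.
\<close>

lemma integral_minus_step_le:
  assumes f: "f \<in> borel_measurable borel" "\<And>x. norm (f x) \<le> B"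
    and P: "finite P" "P \<subseteq> sets borel"
  shows "norm (complex_measure_integral \<mu> f - (\<Sum>\<alpha>\<in>P. c \<alpha> * \<mu> \<alpha>))
           \<le> (\<Sum>j<4. \<integral>x. norm (f x - (\<Sum>\<alpha>\<in>P. c \<alpha> * indicator \<alpha> x)) \<partial>jordan_part \<mu> j)"
proof -
  define h where "h x = (\<Sum>\<alpha>\<in>P. c \<alpha> * indicator \<alpha> x)" for x
  have int_h: "integrable (jordan_part \<mu> j) h"
    and integral_h: "integral\<^sup>L (jordan_part \<mu> j) h = (\<Sum>\<alpha>\<in>P. c \<alpha> * measure (jordan_part \<mu> j) \<alpha>)" for j
  proof -
    interpret finite_measure "jordan_part \<mu> j" by (rule finite_measure_jordan_part)
    have ind: "integrable (jordan_part \<mu> j) (\<lambda>x. c \<alpha> * indicator \<alpha> x)" if "\<alpha> \<in> P" for \<alpha>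
      using that P by (intro integrable_jordan_part[where B = "norm (c \<alpha>)"] borel_measurable_times
          borel_measurable_const borel_measurable_indicator) (auto simp: indicator_def)
    then show "integrable (jordan_part \<mu> j) h"
      unfolding h_def by (intro Bochner_Integration.integrable_sum) auto
    have step: "(\<integral>x. c \<alpha> * indicator \<alpha> x \<partial>jordan_part \<mu> j) = c \<alpha> * measure (jordan_part \<mu> j) \<alpha>"
      if "\<alpha> \<in> P" for \<alpha>
    proof -
      have "(\<lambda>x. c \<alpha> * indicator \<alpha> x) = (\<lambda>x. indicator \<alpha> x *\<^sub>R c \<alpha>)"
        by (auto simp: indicator_def)
      moreover have "has_bochner_integral (jordan_part \<mu> j) (\<lambda>x. indicator \<alpha> x *\<^sub>R c \<alpha>)
          (measure (jordan_part \<mu> j) \<alpha> *\<^sub>R c \<alpha>)"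
        using that P by (intro has_bochner_integral_indicator) (auto simp: emeasure_eq_measure)
      ultimately show ?thesis
        by (simp only: has_bochner_integral_integral_eq scaleR_conv_of_real mult.commute)
    qed
    have "integral\<^sup>L (jordan_part \<mu> j) h = (\<Sum>\<alpha>\<in>P. \<integral>x. c \<alpha> * indicator \<alpha> x \<partial>jordan_part \<mu> j)"
      unfolding h_def by (rule Bochner_Integration.integral_sum) (rule ind)
    also have "\<dots> = (\<Sum>\<alpha>\<in>P. c \<alpha> * measure (jordan_part \<mu> j) \<alpha>)"
      by (intro sum.cong refl) (rule step)
    finally show "integral\<^sup>L (jordan_part \<mu> j) h = (\<Sum>\<alpha>\<in>P. c \<alpha> * measure (jordan_part \<mu> j) \<alpha>)" .
  qed
  note int_f = integrable_jordan_part[OF f]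
  have "(\<Sum>\<alpha>\<in>P. c \<alpha> * \<mu> \<alpha>) = (\<Sum>\<alpha>\<in>P. \<Sum>j<4. \<i> ^ j * (c \<alpha> * measure (jordan_part \<mu> j) \<alpha>))"
    using P by (intro sum.cong refl)
      (simp add: eq_sum_jordan_part subset_iff sum_distrib_left mult.left_commute)
  also have "\<dots> = (\<Sum>j<4. \<i> ^ j * integral\<^sup>L (jordan_part \<mu> j) h)"
    by (subst sum.swap) (simp add: integral_h sum_distrib_left)
  finally have "complex_measure_integral \<mu> f - (\<Sum>\<alpha>\<in>P. c \<alpha> * \<mu> \<alpha>)
      = (\<Sum>j<4. \<i> ^ j * (\<integral>x. f x - h x \<partial>jordan_part \<mu> j))"
    using int_f int_h by (simp add: complex_measure_integral_jordan_part sum_subtractf algebra_simps)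
  also have "norm \<dots> \<le> (\<Sum>j<4. norm (\<i> ^ j * (\<integral>x. f x - h x \<partial>jordan_part \<mu> j)))"
    by (rule norm_sum)
  also have "\<dots> \<le> (\<Sum>j<4. \<integral>x. norm (f x - h x) \<partial>jordan_part \<mu> j)"
    by (intro sum_mono) (simp add: norm_mult norm_power integral_norm_bound)
  finally show ?thesis
    by (simp add: h_def)
qed

text \<open>
  The error depends on \<open>\<mu>\<close> only through the bound \<open>K\<close>, so that one partition with one choice of
  values serves a whole family of measures.
\<close>

lemma riemann_sum_estimate:
  assumes f: "f \<in> borel_measurable borel"
    and P: "finite P" "partition_on UNIV P" "P \<subseteq> sets borel"
    and close: "\<And>\<alpha> x. \<alpha> \<in> P \<Longrightarrow> x \<in> \<alpha> \<Longrightarrow> norm (f x - c \<alpha>) \<le> \<epsilon>"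
  shows "norm (complex_measure_integral \<mu> f - (\<Sum>\<alpha>\<in>P. c \<alpha> * \<mu> \<alpha>)) \<le> 4 * K * \<epsilon>"
proof -
  have near: "norm (f x - (\<Sum>\<alpha>\<in>P. c \<alpha> * indicator \<alpha> x)) \<le> \<epsilon>" for x
  proof -
    obtain \<alpha> where "\<alpha> \<in> P" "x \<in> \<alpha>"
      using P(2) unfolding partition_on_def by blast
    then show ?thesis
      using close partition_sum_indicator[OF P(1,2), of \<alpha> x c] by simp
  qed
  have eps: "0 \<le> \<epsilon>"
    using near norm_ge_zero order_trans by blast
  have step: "(\<lambda>x. \<Sum>\<alpha>\<in>P. c \<alpha> * indicator \<alpha> x) \<in> borel_measurable borel"
    using P(3) by (intro borel_measurable_sum borel_measurable_times borel_measurable_const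
        borel_measurable_indicator) auto
  have bounded: "norm (f x) \<le> \<epsilon> + (\<Sum>\<alpha>\<in>P. norm (c \<alpha>))" for x
  proof -
    have "norm (\<Sum>\<alpha>\<in>P. c \<alpha> * indicator \<alpha> x) \<le> (\<Sum>\<alpha>\<in>P. norm (c \<alpha>))"
      by (intro sum_norm_le) (auto simp: indicator_def)
    with near[of x] show ?thesis
      using norm_triangle_sub[of "f x" "\<Sum>\<alpha>\<in>P. c \<alpha> * indicator \<alpha> x"] by linarith
  qed
  have "(\<integral>x. norm (f x - (\<Sum>\<alpha>\<in>P. c \<alpha> * indicator \<alpha> x)) \<partial>jordan_part \<mu> j) \<le> K * \<epsilon>" for j
  proof -
    interpret finite_measure "jordan_part \<mu> j" by (rule finite_measure_jordan_part)
    have "(\<integral>x. norm (f x - (\<Sum>\<alpha>\<in>P. c \<alpha> * indicator \<alpha> x)) \<partial>jordan_part \<mu> j)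
            \<le> (\<integral>x. \<epsilon> \<partial>jordan_part \<mu> j)"
      using near eps f step
      by (intro integral_mono integrable_jordan_part[where B = \<epsilon>] borel_measurable_norm
          borel_measurable_diff) auto
    also have "\<dots> \<le> K * \<epsilon>"
      using measure_jordan_part_le[of j] eps by (simp add: mult_right_mono)
    finally show ?thesis .
  qed
  then have "(\<Sum>j<4::nat. \<integral>x. norm (f x - (\<Sum>\<alpha>\<in>P. c \<alpha> * indicator \<alpha> x)) \<partial>jordan_part \<mu> j) \<le> 4 * (K * \<epsilon>)"
    using sum_bounded_above[of "{..<4::nat}" _ "K * \<epsilon>"] by simp
  with integral_minus_step_le[OF f bounded P(1,3), of c] show ?thesis
    by simp
qed

lemma norm_integral_le:
  assumes "f \<in> borel_measurable borel" "\<And>x. norm (f x) \<le> B"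
  shows "norm (complex_measure_integral \<mu> f) \<le> 4 * K * B"
  using riemann_sum_estimate[OF assms(1), of "{UNIV}" "\<lambda>_. 0" B] assms(2)
  by (simp add: partition_on_def)

end

text \<open>The pieces are the preimages of the squares of a grid of mesh \<open>\<epsilon> / 2\<close>.\<close>

lemma fine_partition:
  fixes f :: "'a::topological_space \<Rightarrow> complex"
  assumes f: "f \<in> borel_measurable borel" "\<And>x. norm (f x) \<le> B" and "0 < \<epsilon>"
  obtains P p where "finite P" "partition_on UNIV P" "P \<subseteq> sets borel"
    "\<And>\<alpha> x. \<alpha> \<in> P \<Longrightarrow> x \<in> \<alpha> \<Longrightarrow> norm (f x - f (p \<alpha>)) \<le> \<epsilon>"
proof -
  define N where "N = 2 / \<epsilon>"
  have N: "0 < N" using \<open>0 < \<epsilon>\<close> by (simp add: N_def)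
  define g where "g x = (\<lfloor>N * Re (f x)\<rfloor>, \<lfloor>N * Im (f x)\<rfloor>)" for x
  define P where "P = (\<lambda>v. g -` {v}) ` range g"
  define p where "p \<alpha> = (SOME x. x \<in> \<alpha>)" for \<alpha> :: "'a set"
  have "range g \<subseteq> {- \<lceil>N * B\<rceil> - 1..\<lceil>N * B\<rceil>} \<times> {- \<lceil>N * B\<rceil> - 1..\<lceil>N * B\<rceil>}"
  proof -
    have *: "\<lfloor>N * t\<rfloor> \<in> {- \<lceil>N * B\<rceil> - 1..\<lceil>N * B\<rceil>}" if "\<bar>t\<bar> \<le> B" for t
    proof -
      have "\<bar>N * t\<bar> \<le> N * B"
        using that N by (simp add: abs_mult)
      then show ?thesis
        unfolding atLeastAtMost_iff by linarith
    qed
    have "\<bar>Re (f x)\<bar> \<le> B" "\<bar>Im (f x)\<bar> \<le> B" for x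
      using f(2)[of x] abs_Re_le_cmod[of "f x"] abs_Im_le_cmod[of "f x"] by linarith+
    then show ?thesis
      unfolding g_def using * by blast
  qed
  then have finite_range: "finite (range g)"
    by (rule finite_subset) auto
  have p_in: "p \<alpha> \<in> \<alpha>" if "\<alpha> \<in> P" for \<alpha>
  proof -
    have "\<alpha> \<noteq> {}"
      using that by (auto simp: P_def)
    then show ?thesis
      by (simp add: p_def some_in_eq)
  qed
  from finite_range have "finite P"
    by (simp add: P_def)
  moreover have "partition_on UNIV P"
    by (auto simp: P_def partition_on_def disjoint_def)
  moreover have "P \<subseteq> sets borel"
  proof -
    have "g -` {(a, b)} \<in> sets borel" for a b
    proof -
      have "{x \<in> space borel. \<lfloor>N * Re (f x)\<rfloor> = a \<and> \<lfloor>N * Im (f x)\<rfloor> = b} \<in> sets borel"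
        using f(1) by measurable
      then show ?thesis
        by (simp add: g_def vimage_def)
    qed
    then show ?thesis
      unfolding P_def by (metis image_subsetI prod.collapse)
  qed
  moreover have "norm (f x - f (p \<alpha>)) \<le> \<epsilon>" if "\<alpha> \<in> P" "x \<in> \<alpha>" for \<alpha> x
  proof -
    have close: "\<bar>s - t\<bar> \<le> \<epsilon> / 2" if "\<lfloor>N * s\<rfloor> = \<lfloor>N * t\<rfloor>" for s t
    proof -
      have "\<bar>N * s - N * t\<bar> \<le> 1"
        using that by linarith
      then have "N * \<bar>s - t\<bar> \<le> 1"
        using N by (simp add: abs_mult flip: right_diff_distrib)
      then show ?thesis
        using \<open>0 < \<epsilon>\<close> by (simp add: N_def field_simps)
    qed
    have "g x = g (p \<alpha>)"
      using that p_in[OF that(1)] by (auto simp: P_def)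
    then have "\<bar>Re (f x - f (p \<alpha>))\<bar> \<le> \<epsilon> / 2" "\<bar>Im (f x - f (p \<alpha>))\<bar> \<le> \<epsilon> / 2"
      using close[of "Re (f x)" "Re (f (p \<alpha>))"] close[of "Im (f x)" "Im (f (p \<alpha>))"]
      by (simp_all add: g_def)
    then show ?thesis
      using cmod_le[of "f x - f (p \<alpha>)"] by linarith
  qed
  ultimately show ?thesis
    by (rule that)
qed

lemma sum_le_tv_norm:
  assumes "finite P" "partition_on UNIV P" "P \<subseteq> sets borel"
  shows "(\<Sum>\<alpha>\<in>P. ennreal (cmod (\<mu> \<alpha>))) \<le> tv_norm \<mu>"
  unfolding tv_norm_def
  by (rule SUP_upper[of P _ "\<lambda>P. \<Sum>\<alpha>\<in>P. ennreal (cmod (\<mu> \<alpha>))"]) (use assms in simp)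

context bounded_complex_measure
begin

text \<open>
  A step function with values bounded by \<open>B\<close> has an integral of modulus at most \<open>B\<close> times the sum
  of \<open>\<bar>\<mu> \<alpha>\<bar>\<close> over its pieces, and Riemann sums reach \<open>f\<close> with values taken by \<open>f\<close> itself.
\<close>

lemma norm_integral_le_tv_norm:
  assumes f: "f \<in> borel_measurable borel" "\<And>x. norm (f x) \<le> B"
  shows "ennreal (norm (complex_measure_integral \<mu> f)) \<le> ennreal B * tv_norm \<mu>"
proof (rule ennreal_le_epsilon)
  fix e :: real
  assume "0 < e"
  have B: "0 \<le> B"
    using f(2) norm_ge_zero order_trans by blast
  define \<epsilon> where "\<epsilon> = e / (4 * K + 1)"
  have \<epsilon>: "0 < \<epsilon>" "4 * K * \<epsilon> \<le> e"
    using \<open>0 < e\<close> bound_nonneg by (auto simp: \<epsilon>_def field_simps)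
  obtain P p where P: "finite P" "partition_on UNIV P" "P \<subseteq> sets borel"
    and p: "\<And>\<alpha> x. \<alpha> \<in> P \<Longrightarrow> x \<in> \<alpha> \<Longrightarrow> norm (f x - f (p \<alpha>)) \<le> \<epsilon>"
    using fine_partition[OF f \<epsilon>(1)] by metis
  have "norm (complex_measure_integral \<mu> f - (\<Sum>\<alpha>\<in>P. f (p \<alpha>) * \<mu> \<alpha>)) \<le> e"
    using riemann_sum_estimate[OF f(1) P, of "\<lambda>\<alpha>. f (p \<alpha>)" \<epsilon>] p \<epsilon>(2) by fastforce
  moreover have "norm (\<Sum>\<alpha>\<in>P. f (p \<alpha>) * \<mu> \<alpha>) \<le> B * (\<Sum>\<alpha>\<in>P. norm (\<mu> \<alpha>))"
    unfolding sum_distrib_left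
    by (intro sum_norm_le) (simp add: norm_mult f(2) mult_right_mono)
  ultimately have "norm (complex_measure_integral \<mu> f) \<le> B * (\<Sum>\<alpha>\<in>P. norm (\<mu> \<alpha>)) + e"
    using norm_triangle_sub[of "complex_measure_integral \<mu> f" "\<Sum>\<alpha>\<in>P. f (p \<alpha>) * \<mu> \<alpha>"] by linarith
  then have "ennreal (norm (complex_measure_integral \<mu> f)) \<le> ennreal (B * (\<Sum>\<alpha>\<in>P. norm (\<mu> \<alpha>)) + e)"
    by (rule ennreal_leI)
  also have "\<dots> = ennreal B * (\<Sum>\<alpha>\<in>P. ennreal (norm (\<mu> \<alpha>))) + ennreal e"
    using B \<open>0 < e\<close> by (simp add: ennreal_mult sum_nonneg)
  also have "\<dots> \<le> ennreal B * tv_norm \<mu> + ennreal e"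
    by (intro add_right_mono mult_left_mono sum_le_tv_norm P) simp
  finally show "ennreal (norm (complex_measure_integral \<mu> f)) \<le> ennreal B * tv_norm \<mu> + ennreal e" .
qed

end

section \<open>Approximating Borel sets by continuous functions\<close>

lemma compact_t2_imp_normal_regular:
  assumes "compact (UNIV :: 'a::t2_space set)"
  shows "normal_space (euclidean :: 'a topology)" "regular_space (euclidean :: 'a topology)"
proof -
  have "compact_space (euclidean :: 'a topology)"
    using assms by (simp add: compact_space_def)
  moreover have "Hausdorff_space (euclidean :: 'a topology)"
    unfolding Hausdorff_space_def disjnt_def by simp (metis hausdorff)
  ultimately show "normal_space (euclidean :: 'a topology)" "regular_space (euclidean :: 'a topology)"
    by (simp_all add: compact_Hausdorff_or_regular_imp_normal_space compact_Hausdorff_imp_regular_space)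
qed

text \<open>By regularity \<open>U\<close> is covered by the basic open sets whose closure lies in \<open>U\<close>.\<close>

lemma open_eq_UN_closed:
  fixes U :: "'a::{second_countable_topology, t2_space} set"
  assumes "compact (UNIV :: 'a set)" "open U"
  obtains C :: "nat \<Rightarrow> 'a set" where "\<And>n. closed (C n)" "U = (\<Union>n. C n)"
proof -
  obtain B :: "'a set set" where B: "countable B" "topological_basis B"
    using ex_countable_basis by blast
  define S where "S = insert {} (closure ` {b \<in> B. closure b \<subseteq> U})"
  have "U \<subseteq> \<Union>S"
  proof
    fix x assume "x \<in> U"
    then obtain V where V: "open V" "x \<in> V" "closure V \<subseteq> U"
      using compact_t2_imp_normal_regular(2)[OF assms(1)] assms(2)
      unfolding regular_space by (force simp: disjnt_def dest: spec[of _ "- U"])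
    then obtain b where "b \<in> B" "x \<in> b" "b \<subseteq> V"
      using topological_basisE[OF B(2)] by metis
    with V have "closure b \<subseteq> U" "x \<in> closure b"
      using closure_mono closure_subset by blast+
    with \<open>b \<in> B\<close> show "x \<in> \<Union>S"
      by (auto simp: S_def)
  qed
  then have "U = \<Union>S"
    by (auto simp: S_def)
  moreover have "range (from_nat_into S) = S"
    using B(1) by (intro range_from_nat_into) (auto simp: S_def)
  moreover have "closed c" if "c \<in> S" for c
    using that by (auto simp: S_def)
  ultimately show ?thesis
    using that[of "from_nat_into S"] by (metis rangeI)
qed

lemma integral_abs_le_measure:
  fixes h :: "'a \<Rightarrow> real"
  assumes "finite_measure M" "h \<in> borel_measurable M" "T \<in> sets M" "\<And>x. \<bar>h x\<bar> \<le> indicator T x"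
  shows "(\<integral>x. \<bar>h x\<bar> \<partial>M) \<le> measure M T"
proof -
  interpret finite_measure M by fact
  have "\<bar>h x\<bar> \<le> 1" for x
    using assms(4)[of x] indicator_le_1[of T x, where ?'a = real] by linarith
  then have "integrable M h"
    using assms(2) by (intro integrable_const_bound[of _ 1]) auto
  then have "(\<integral>x. \<bar>h x\<bar> \<partial>M) \<le> (\<integral>x. indicator T x \<partial>M)"
    using assms by (intro integral_mono) (auto simp: emeasure_eq_measure)
  then show ?thesis
    using assms(3) sets.sets_into_space[OF assms(3)] by (simp add: Int_absorb2)
qed

lemma finitely_many_tails_small:
  fixes M :: "'i \<Rightarrow> 'a::topological_space measure"
  assumes "finite I" "\<And>i. i \<in> I \<Longrightarrow> finite_measure (M i)" "\<And>i. i \<in> I \<Longrightarrow> sets (M i) = sets borel"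
    and D: "\<And>n::nat. D n \<in> sets borel" and "0 < \<epsilon>"
  shows "\<exists>n. \<forall>i\<in>I. measure (M i) ((\<Union>k. D k) - (\<Union>k<n. D k)) < \<epsilon>"
proof -
  have "\<forall>\<^sub>F n in sequentially. measure (M i) ((\<Union>k. D k) - (\<Union>k<n. D k)) < \<epsilon>" if "i \<in> I" for i
  proof -
    interpret finite_measure "M i" using assms(2) that .
    have "(\<lambda>n. measure (M i) ((\<Union>k. D k) - (\<Union>k<n. D k)))
            \<longlonglongrightarrow> measure (M i) (\<Inter>n. (\<Union>k. D k) - (\<Union>k<n. D k))"
      using D assms(3)[OF that]
      by (intro finite_Lim_measure_decseq) (auto simp: decseq_def)
    moreover have "(\<Inter>n. (\<Union>k. D k) - (\<Union>k<n. D k)) = {}"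
      by auto
    ultimately have "(\<lambda>n. measure (M i) ((\<Union>k. D k) - (\<Union>k<n. D k))) \<longlonglongrightarrow> 0"
      by (simp only: measure_empty)
    then show ?thesis
      using \<open>0 < \<epsilon>\<close> by (rule order_tendstoD(2))
  qed
  then have "\<forall>\<^sub>F n in sequentially. \<forall>i\<in>I. measure (M i) ((\<Union>k. D k) - (\<Union>k<n. D k)) < \<epsilon>"
    using assms(1) by (simp add: eventually_ball_finite)
  then show ?thesis
    using eventually_happens'[OF sequentially_bot] by blast
qed

text \<open>
  One function has to approximate with respect to several measures at once, because it will be
  integrated against all four Jordan parts of a complex measure.

  The sets whose indicator can be approximated form a \<open>\<sigma>\<close>-algebra: \<open>1 - g\<close> serves the complement and
  a truncated sum of finitely many functions serves a union up to a small tail.  An open set \<open>U\<close> is a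
  countable union of closed sets; finitely many of these exhaust \<open>U\<close> up to a small tail, and
  Urysohn's lemma separates them from the complement of \<open>U\<close>.
\<close>

lemma borel_indicator_L1_approx:
  fixes M :: "'i \<Rightarrow> 'a::{second_countable_topology, t2_space} measure"
  assumes compact: "compact (UNIV :: 'a set)" and I: "finite I"
    and M: "\<And>i. i \<in> I \<Longrightarrow> finite_measure (M i)" "\<And>i. i \<in> I \<Longrightarrow> sets (M i) = sets borel"
    and "\<alpha> \<in> sets borel" "0 < \<epsilon>"
  shows "\<exists>g :: 'a \<Rightarrow> real. continuous_on UNIV g \<and> (\<forall>x. 0 \<le> g x \<and> g x \<le> 1) \<and>
           (\<forall>i\<in>I. (\<integral>x. \<bar>g x - indicator \<alpha> x\<bar> \<partial>M i) \<le> \<epsilon>)"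
proof -
  have meas: "f \<in> borel_measurable (M i)" if "i \<in> I" "f \<in> borel_measurable borel" for i and f :: "'a \<Rightarrow> real"
    using that measurable_cong_sets[OF M(2)[OF that(1)] refl] by blast
  have "\<alpha> \<in> sigma_sets UNIV {U. open U}"
    using \<open>\<alpha> \<in> sets borel\<close> by (simp add: borel_def)
  then show ?thesis
    using \<open>0 < \<epsilon>\<close>
  proof (induction arbitrary: \<epsilon>)
    case (Basic U)
    then have "open U" by simp
    obtain C where C: "\<And>n::nat. closed (C n)" "U = (\<Union>n. C n)"
      using open_eq_UN_closed[OF compact \<open>open U\<close>] by blast
    obtain n where "\<forall>i\<in>I. measure (M i) (U - (\<Union>k<n. C k)) < \<epsilon>"
      using finitely_many_tails_small[where M = M and D = C, OF I M borel_closed[OF C(1)] Basic.prems]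
      unfolding C(2) ..
    then have n: "measure (M i) (U - (\<Union>k<n. C k)) < \<epsilon>" if "i \<in> I" for i
      using that ..
    define K where "K = (\<Union>k<n. C k)"
    have K: "closed K" "K \<subseteq> U"
      using C by (auto simp: K_def intro!: closed_UN)
    obtain g where g: "continuous_map euclidean (top_of_set {0..1::real}) g" "g ` (- U) \<subseteq> {0}" "g ` K \<subseteq> {1}"
      using Urysohn_lemma[OF compact_t2_imp_normal_regular(1)[OF compact], of "- U" K 0 1]
        K \<open>open U\<close> by (auto simp: disjnt_def)
    have cont: "continuous_on UNIV g" and range: "0 \<le> g x" "g x \<le> 1" for x
      using g(1) by (auto simp: continuous_map_in_subtopology)
    have "(\<integral>x. \<bar>g x - indicator U x\<bar> \<partial>M i) \<le> \<epsilon>" if "i \<in> I" for i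
    proof -
      have "(\<integral>x. \<bar>g x - indicator U x\<bar> \<partial>M i) \<le> measure (M i) (U - K)"
      proof (rule integral_abs_le_measure[OF M(1)[OF that]])
        show "(\<lambda>x. g x - indicator U x) \<in> borel_measurable (M i)"
          using \<open>open U\<close> borel_measurable_continuous_onI[OF cont]
          by (intro meas[OF that] borel_measurable_diff borel_measurable_indicator) auto
        show "U - K \<in> sets (M i)"
          using K \<open>open U\<close> M(2)[OF that] by auto
        fix x
        consider "x \<in> - U" | "x \<in> K" | "x \<in> U - K" by blast
        then show "\<bar>g x - indicator U x\<bar> \<le> indicator (U - K) x"
          using g(2,3) K(2) range[of x] by cases (auto simp: image_subset_iff subset_iff)
      qed
      also have "\<dots> \<le> \<epsilon>"
        using n[OF that] by (simp add: K_def)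
      finally show ?thesis .
    qed
    with cont range show ?case by blast
  next
    case Empty
    then show ?case
      by (intro exI[of _ "\<lambda>_. 0"]) auto
  next
    case (Compl \<beta>)
    then obtain g :: "'a \<Rightarrow> real" where g: "continuous_on UNIV g" "\<And>x. 0 \<le> g x \<and> g x \<le> 1"
      "\<And>i. i \<in> I \<Longrightarrow> (\<integral>x. \<bar>g x - indicator \<beta> x\<bar> \<partial>M i) \<le> \<epsilon>"
      by blast
    have "\<bar>(1 - g x) - indicator (UNIV - \<beta>) x\<bar> = \<bar>g x - indicator \<beta> x\<bar>" for x
      by (auto simp: indicator_def)
    with g show ?case
      by (intro exI[of _ "\<lambda>x. 1 - g x"]) (simp add: continuous_on_diff)
  next
    case (Union D)
    have D: "D n \<in> sets borel" for n
      using Union.hyps by (simp add: borel_def)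
    obtain n where "\<forall>i\<in>I. measure (M i) ((\<Union>k. D k) - (\<Union>k<n. D k)) < \<epsilon> / 2"
      using finitely_many_tails_small[where M = M and D = D, OF I M D half_gt_zero[OF Union.prems]] ..
    then have n: "measure (M i) ((\<Union>k. D k) - (\<Union>k<n. D k)) < \<epsilon> / 2" if "i \<in> I" for i
      using that ..
    define \<delta> where "\<delta> = \<epsilon> / (2 * (real n + 1))"
    have \<delta>: "0 < \<delta>" "n * \<delta> \<le> \<epsilon> / 2"
      using Union.prems by (auto simp: \<delta>_def field_simps)
    have "\<forall>k. \<exists>g :: 'a \<Rightarrow> real. continuous_on UNIV g \<and> (\<forall>x. 0 \<le> g x \<and> g x \<le> 1) \<and>
           (\<forall>i\<in>I. (\<integral>x. \<bar>g x - indicator (D k) x\<bar> \<partial>M i) \<le> \<delta>)"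
      using Union.IH \<delta>(1) by blast
    then obtain g :: "nat \<Rightarrow> 'a \<Rightarrow> real" where g: "\<And>k. continuous_on UNIV (g k)"
      "\<And>k x. 0 \<le> g k x" "\<And>k x. g k x \<le> 1"
      "\<And>k i. i \<in> I \<Longrightarrow> (\<integral>x. \<bar>g k x - indicator (D k) x\<bar> \<partial>M i) \<le> \<delta>"
      by metis
    define G where "G x = min 1 (\<Sum>k<n. g k x)" for x
    define V where "V = (\<Union>k<n. D k)"
    define T where "T = (\<Union>k. D k) - V"
    have cont: "continuous_on UNIV G"
      unfolding G_def by (intro continuous_intros g(1))
    have range: "0 \<le> G x" "G x \<le> 1" for x
      by (auto simp: G_def g(2) sum_nonneg)
    have near_V: "\<bar>G x - indicator V x\<bar> \<le> (\<Sum>k<n. \<bar>g k x - indicator (D k) x\<bar>)" for x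
    proof (cases "x \<in> V")
      case False
      then have "(\<Sum>k<n. \<bar>g k x - indicator (D k) x\<bar>) = (\<Sum>k<n. g k x)"
        by (intro sum.cong) (auto simp: V_def g(2))
      with False range[of x] show ?thesis
        by (simp add: G_def)
    next
      case True
      then obtain k where k: "k < n" "x \<in> D k"
        by (auto simp: V_def)
      have "g k x \<le> (\<Sum>k<n. g k x)"
        using k g(2) by (intro member_le_sum) auto
      then have "g k x \<le> G x"
        using g(3) by (simp add: G_def)
      moreover have "\<bar>g k x - indicator (D k) x\<bar> \<le> (\<Sum>k<n. \<bar>g k x - indicator (D k) x\<bar>)"
        using k by (intro member_le_sum) auto
      ultimately show ?thesis
        using True k range[of x] g(3)[of k x] by simp
    qed
    have near: "\<bar>G x - indicator (\<Union>k. D k) x\<bar> \<le> (\<Sum>k<n. \<bar>g k x - indicator (D k) x\<bar>) + indicator T x" for x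
    proof -
      have "indicator (\<Union>k. D k) x = indicator V x + (indicator T x :: real)"
        by (auto simp: T_def V_def indicator_def)
      moreover have "0 \<le> (indicator T x :: real)"
        by simp
      ultimately show ?thesis
        using near_V[of x] by linarith
    qed
    have "(\<integral>x. \<bar>G x - indicator (\<Union>k. D k) x\<bar> \<partial>M i) \<le> \<epsilon>" if "i \<in> I" for i
    proof -
      interpret finite_measure "M i" using M(1)[OF that] .
      have T: "T \<in> sets (M i)"
        using D M(2)[OF that] by (auto simp: T_def V_def)
      have int: "integrable (M i) (\<lambda>x. \<bar>h x - indicator \<beta> x\<bar>)"
        if h: "continuous_on UNIV h" "\<And>x. 0 \<le> h x" "\<And>x. h x \<le> 1" and "\<beta> \<in> sets borel"
        for h :: "'a \<Rightarrow> real" and \<beta>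
      proof (rule integrable_const_bound[of _ 1])
        show "AE x in M i. norm \<bar>h x - indicator \<beta> x\<bar> \<le> 1"
        proof (rule AE_I2)
          show "norm \<bar>h x - indicator \<beta> x\<bar> \<le> 1" for x
            using h(2,3)[of x] by (cases "x \<in> \<beta>") simp_all
        qed
        show "(\<lambda>x. \<bar>h x - indicator \<beta> x\<bar>) \<in> borel_measurable (M i)"
          using that borel_measurable_continuous_onI[OF h(1)]
          by (intro meas[OF \<open>i \<in> I\<close>] borel_measurable_abs borel_measurable_diff borel_measurable_indicator)
      qed
      have "(\<integral>x. \<bar>G x - indicator (\<Union>k. D k) x\<bar> \<partial>M i)
          \<le> (\<integral>x. (\<Sum>k<n. \<bar>g k x - indicator (D k) x\<bar>) + indicator T x \<partial>M i)"
        using near D T g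
        by (intro integral_mono Bochner_Integration.integrable_add Bochner_Integration.integrable_sum int cont range)
          (auto simp: emeasure_eq_measure)
      also have "\<dots> = (\<Sum>k<n. \<integral>x. \<bar>g k x - indicator (D k) x\<bar> \<partial>M i) + measure (M i) T"
        using D T g sets.sets_into_space[OF T]
        by (subst Bochner_Integration.integral_add Bochner_Integration.integral_sum;
            auto intro!: int Bochner_Integration.integrable_sum simp: emeasure_eq_measure Int_absorb2)+
      also have "\<dots> \<le> n * \<delta> + \<epsilon> / 2"
        using n[OF that] sum_bounded_above[of "{..<n}" _ \<delta>] g(4)[OF that]
        by (intro add_mono) (auto simp: T_def V_def)
      finally show ?thesis
        using \<delta>(2) by simp
    qed
    with cont range show ?case by blast
  qed
qed

section \<open>Total variation as the norm of the integration functional\<close>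

lemma cmod_cis_diff_le: "cmod (cis a - cis b) \<le> \<bar>a - b\<bar>"
proof -
  have "cis a - cis b = cis b * (exp (\<i> * of_real (a - b)) - 1)"
    unfolding cis_conv_exp[of "a - b", symmetric] by (simp add: algebra_simps cis_mult)
  then have "cmod (cis a - cis b) = 2 * \<bar>sin ((a - b) / 2)\<bar>"
    by (simp add: norm_mult dist_exp_i_1 del: of_real_diff)
  with abs_sin_x_le_abs_x[of "(a - b) / 2"] show ?thesis
    by simp
qed

text \<open>
  On a finite partition choose angles \<open>\<theta> \<alpha>\<close> with \<open>cis (\<theta> \<alpha>) * \<mu> \<alpha> = \<bar>\<mu> \<alpha>\<bar>\<close>, so that the step
  function with values \<open>cis (\<theta> \<alpha>)\<close> has integral \<open>\<Sum>\<bar>\<mu> \<alpha>\<bar>\<close>.  Approximating the indicators of the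
  pieces inside the exponent, rather than the step function itself, gives a continuous function
  that has modulus one everywhere, and nothing is lost since \<open>cis\<close> does not increase distances.
\<close>

lemma tv_norm_le_if_integrals_le:
  fixes \<mu> :: "'a::{second_countable_topology, t2_space} set \<Rightarrow> complex"
  assumes "bounded_complex_measure \<mu> K" and compact: "compact (UNIV :: 'a set)"
    and le: "\<And>f. continuous_on UNIV f \<Longrightarrow> (\<And>x. norm (f x) \<le> 1) \<Longrightarrow>
               norm (complex_measure_integral \<mu> f) \<le> r"
  shows "tv_norm \<mu> \<le> ennreal r"
  unfolding tv_norm_def
proof (intro SUP_least)
  interpret bounded_complex_measure \<mu> K by fact
  fix P :: "'a set set"
  assume "P \<in> {P. finite P \<and> partition_on UNIV P \<and> P \<subseteq> sets borel}"
  then have P: "finite P" "partition_on UNIV P" "P \<subseteq> sets borel"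
    by auto
  define \<theta> where "\<theta> \<alpha> = - Arg (\<mu> \<alpha>)" for \<alpha>
  have \<theta>: "cis (\<theta> \<alpha>) * \<mu> \<alpha> = of_real (norm (\<mu> \<alpha>))" for \<alpha>
  proof -
    have "cis (\<theta> \<alpha>) * rcis (cmod (\<mu> \<alpha>)) (Arg (\<mu> \<alpha>)) = of_real (norm (\<mu> \<alpha>))"
      by (simp add: \<theta>_def rcis_def mult.left_commute cis_mult)
    then show ?thesis
      by (simp add: rcis_cmod_Arg)
  qed
  have "(\<Sum>\<alpha>\<in>P. norm (\<mu> \<alpha>)) \<le> r + e" if "0 < e" for e
  proof -
    define S where "S = (\<Sum>\<alpha>\<in>P. \<bar>\<theta> \<alpha>\<bar>)"
    have S: "0 \<le> S" by (simp add: S_def sum_nonneg)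
    \<comment> \<open>each of the four Jordan parts will contribute an error of at most \<open>S * \<delta>\<close>\<close>
    define \<delta> where "\<delta> = e / (4 * S + 1)"
    have \<delta>: "0 < \<delta>" "4 * (S * \<delta>) \<le> e"
      using that S by (auto simp: \<delta>_def field_simps)
    have "\<exists>g :: 'a \<Rightarrow> real. continuous_on UNIV g \<and> (\<forall>x. 0 \<le> g x \<and> g x \<le> 1) \<and>
            (\<forall>j\<in>{..<4}. (\<integral>x. \<bar>g x - indicator \<alpha> x\<bar> \<partial>jordan_part \<mu> j) \<le> \<delta>)" if "\<alpha> \<in> P" for \<alpha>
      by (rule borel_indicator_L1_approx[OF compact, where M = "jordan_part \<mu>"])
        (use that P(3) \<delta>(1) in \<open>auto simp: finite_measure_jordan_part\<close>)
    then obtain g :: "'a set \<Rightarrow> 'a \<Rightarrow> real" where g: "\<And>\<alpha>. \<alpha> \<in> P \<Longrightarrow> continuous_on UNIV (g \<alpha>)"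
      "\<And>\<alpha> x. \<alpha> \<in> P \<Longrightarrow> 0 \<le> g \<alpha> x" "\<And>\<alpha> x. \<alpha> \<in> P \<Longrightarrow> g \<alpha> x \<le> 1"
      "\<And>\<alpha> j. \<alpha> \<in> P \<Longrightarrow> j < 4 \<Longrightarrow> (\<integral>x. \<bar>g \<alpha> x - indicator \<alpha> x\<bar> \<partial>jordan_part \<mu> j) \<le> \<delta>"
      unfolding Ball_def[of "{..<4}"] lessThan_iff by metis
    define f where "f x = cis (\<Sum>\<alpha>\<in>P. \<theta> \<alpha> * g \<alpha> x)" for x
    have cont: "continuous_on UNIV f"
      unfolding f_def using g(1) by (intro continuous_on_cis continuous_on_sum continuous_on_mult continuous_on_const)
    have f: "f \<in> borel_measurable borel" "norm (f x) \<le> 1" for x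
      using borel_measurable_continuous_onI[OF cont] by (simp_all add: f_def)
    have dev_int: "integrable (jordan_part \<mu> j) (\<lambda>x. \<bar>g \<alpha> x - indicator \<alpha> x\<bar>)" if "\<alpha> \<in> P" for \<alpha> j
    proof (rule integrable_jordan_part[where B = 1])
      show "(\<lambda>x. \<bar>g \<alpha> x - indicator \<alpha> x\<bar>) \<in> borel_measurable borel"
        using that P(3) borel_measurable_continuous_onI[OF g(1)[OF that]]
        by (intro borel_measurable_abs borel_measurable_diff borel_measurable_indicator) auto
      show "norm \<bar>g \<alpha> x - indicator \<alpha> x\<bar> \<le> 1" for x
        using g(2,3)[OF that, of x] by (cases "x \<in> \<alpha>") simp_all
    qed
    have step: "(\<lambda>x. \<Sum>\<alpha>\<in>P. cis (\<theta> \<alpha>) * indicator \<alpha> x) \<in> borel_measurable borel"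
      using P(3) by (intro borel_measurable_sum borel_measurable_times borel_measurable_const
          borel_measurable_indicator) auto
    have near: "norm (f x - (\<Sum>\<alpha>\<in>P. cis (\<theta> \<alpha>) * indicator \<alpha> x))
                  \<le> (\<Sum>\<alpha>\<in>P. \<bar>\<theta> \<alpha>\<bar> * \<bar>g \<alpha> x - indicator \<alpha> x\<bar>)" for x
    proof -
      obtain \<alpha> where \<alpha>: "\<alpha> \<in> P" "x \<in> \<alpha>"
        using P(2) unfolding partition_on_def by blast
      have "(\<Sum>\<alpha>\<in>P. cis (\<theta> \<alpha>) * indicator \<alpha> x) = cis (\<Sum>\<alpha>\<in>P. \<theta> \<alpha> * indicator \<alpha> x)"
        unfolding partition_sum_indicator[OF P(1,2) \<alpha>] ..
      then have "norm (f x - (\<Sum>\<alpha>\<in>P. cis (\<theta> \<alpha>) * indicator \<alpha> x))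
          \<le> \<bar>(\<Sum>\<alpha>\<in>P. \<theta> \<alpha> * g \<alpha> x) - (\<Sum>\<alpha>\<in>P. \<theta> \<alpha> * indicator \<alpha> x)\<bar>"
        by (simp add: f_def cmod_cis_diff_le)
      also have "\<dots> = \<bar>\<Sum>\<alpha>\<in>P. \<theta> \<alpha> * (g \<alpha> x - indicator \<alpha> x)\<bar>"
        by (simp add: sum_subtractf right_diff_distrib)
      also have "\<dots> \<le> (\<Sum>\<alpha>\<in>P. \<bar>\<theta> \<alpha>\<bar> * \<bar>g \<alpha> x - indicator \<alpha> x\<bar>)"
        unfolding abs_mult[symmetric] by (rule sum_abs)
      finally show ?thesis .
    qed
    have part: "(\<integral>x. norm (f x - (\<Sum>\<alpha>\<in>P. cis (\<theta> \<alpha>) * indicator \<alpha> x)) \<partial>jordan_part \<mu> j) \<le> S * \<delta>"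
      if "j < 4" for j
    proof -
      have "(\<integral>x. norm (f x - (\<Sum>\<alpha>\<in>P. cis (\<theta> \<alpha>) * indicator \<alpha> x)) \<partial>jordan_part \<mu> j)
          \<le> (\<integral>x. (\<Sum>\<alpha>\<in>P. \<bar>\<theta> \<alpha>\<bar> * \<bar>g \<alpha> x - indicator \<alpha> x\<bar>) \<partial>jordan_part \<mu> j)"
      proof (rule integral_mono)
        have "norm (f x - (\<Sum>\<alpha>\<in>P. cis (\<theta> \<alpha>) * indicator \<alpha> x)) \<le> S" for x
        proof (rule order_trans[OF near])
          have "\<bar>\<theta> \<alpha>\<bar> * \<bar>g \<alpha> x - indicator \<alpha> x\<bar> \<le> \<bar>\<theta> \<alpha>\<bar>" if "\<alpha> \<in> P" for \<alpha>
            using g(2,3)[OF that, of x] by (intro mult_left_le) (cases "x \<in> \<alpha>"; simp)+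
          then show "(\<Sum>\<alpha>\<in>P. \<bar>\<theta> \<alpha>\<bar> * \<bar>g \<alpha> x - indicator \<alpha> x\<bar>) \<le> S"
            unfolding S_def by (rule sum_mono)
        qed
        then show "integrable (jordan_part \<mu> j) (\<lambda>x. norm (f x - (\<Sum>\<alpha>\<in>P. cis (\<theta> \<alpha>) * indicator \<alpha> x)))"
          using f(1) step
          by (intro integrable_jordan_part[where B = S] borel_measurable_norm borel_measurable_diff) auto
        show "integrable (jordan_part \<mu> j) (\<lambda>x. \<Sum>\<alpha>\<in>P. \<bar>\<theta> \<alpha>\<bar> * \<bar>g \<alpha> x - indicator \<alpha> x\<bar>)"
          by (intro Bochner_Integration.integrable_sum integrable_mult_right dev_int)
      qed (rule near)
      also have "\<dots> = (\<Sum>\<alpha>\<in>P. \<bar>\<theta> \<alpha>\<bar> * (\<integral>x. \<bar>g \<alpha> x - indicator \<alpha> x\<bar> \<partial>jordan_part \<mu> j))"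
        by (simp add: Bochner_Integration.integral_sum dev_int)
      also have "\<dots> \<le> (\<Sum>\<alpha>\<in>P. \<bar>\<theta> \<alpha>\<bar> * \<delta>)"
        using g(4) that by (intro sum_mono mult_left_mono) auto
      finally show ?thesis
        by (simp add: S_def sum_distrib_right)
    qed
    have "(\<Sum>j<4::nat. \<integral>x. norm (f x - (\<Sum>\<alpha>\<in>P. cis (\<theta> \<alpha>) * indicator \<alpha> x)) \<partial>jordan_part \<mu> j) \<le> 4 * (S * \<delta>)"
      using part sum_bounded_above[of "{..<4::nat}" _ "S * \<delta>"] by simp
    then have "norm (complex_measure_integral \<mu> f - (\<Sum>\<alpha>\<in>P. cis (\<theta> \<alpha>) * \<mu> \<alpha>)) \<le> e"
      using integral_minus_step_le[OF f P(1,3), of "\<lambda>\<alpha>. cis (\<theta> \<alpha>)"] \<delta>(2) by linarith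
    moreover have "norm (\<Sum>\<alpha>\<in>P. cis (\<theta> \<alpha>) * \<mu> \<alpha>) = (\<Sum>\<alpha>\<in>P. norm (\<mu> \<alpha>))"
      unfolding \<theta> of_real_sum[symmetric] norm_of_real by (simp add: sum_nonneg)
    ultimately show ?thesis
      using le[OF cont f(2)]
        norm_triangle_sub[of "\<Sum>\<alpha>\<in>P. cis (\<theta> \<alpha>) * \<mu> \<alpha>" "complex_measure_integral \<mu> f"]
      by (simp add: norm_minus_commute)
  qed
  then have "(\<Sum>\<alpha>\<in>P. norm (\<mu> \<alpha>)) \<le> r"
    by (rule field_le_epsilon)
  then show "(\<Sum>\<alpha>\<in>P. ennreal (norm (\<mu> \<alpha>))) \<le> ennreal r"
    by (simp add: ennreal_leI)
qed

text \<open>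
  One sequence of Riemann sums serves all measures, so that relations which the Riemann sums satisfy
  pass to the integrals of several measures, and to operator-valued sums.
\<close>

lemma riemann_sums:
  fixes f :: "'a::topological_space \<Rightarrow> complex"
  assumes f: "f \<in> borel_measurable borel" "\<And>x. norm (f x) \<le> B"
  obtains P :: "nat \<Rightarrow> 'a set set" and c :: "nat \<Rightarrow> 'a set \<Rightarrow> complex" where "\<And>n. P n \<subseteq> sets borel"
    "\<And>\<mu> K n. bounded_complex_measure \<mu> K \<Longrightarrow>
       norm (complex_measure_integral \<mu> f - (\<Sum>\<alpha>\<in>P n. c n \<alpha> * \<mu> \<alpha>)) \<le> 4 * K / real (Suc n)"
proof -
  have "\<forall>n. \<exists>P c. P \<subseteq> sets borel \<and> (\<forall>\<mu> K. bounded_complex_measure \<mu> K \<longrightarrow>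
       norm (complex_measure_integral \<mu> f - (\<Sum>\<alpha>\<in>P. c \<alpha> * \<mu> \<alpha>)) \<le> 4 * K / real (Suc n))"
  proof
    fix n :: nat
    have "0 < inverse (real (Suc n))"
      by simp
    then obtain P p where P: "finite P" "partition_on UNIV P" "P \<subseteq> sets borel"
      and p: "\<And>\<alpha> x. \<alpha> \<in> P \<Longrightarrow> x \<in> \<alpha> \<Longrightarrow> norm (f x - f (p \<alpha>)) \<le> inverse (real (Suc n))"
      using fine_partition[OF f] by metis
    have "norm (complex_measure_integral \<mu> f - (\<Sum>\<alpha>\<in>P. f (p \<alpha>) * \<mu> \<alpha>)) \<le> 4 * K / real (Suc n)"
      if "bounded_complex_measure \<mu> K" for \<mu> K
      unfolding divide_inverse
      by (rule bounded_complex_measure.riemann_sum_estimate[OF that f(1) P p])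
    with P(3) show "\<exists>P c. P \<subseteq> sets borel \<and> (\<forall>\<mu> K. bounded_complex_measure \<mu> K \<longrightarrow>
       norm (complex_measure_integral \<mu> f - (\<Sum>\<alpha>\<in>P. c \<alpha> * \<mu> \<alpha>)) \<le> 4 * K / real (Suc n))"
      by (intro exI[of _ P] exI[of _ "\<lambda>\<alpha>. f (p \<alpha>)"]) simp
  qed
  then obtain P c where "\<forall>n. P n \<subseteq> sets borel \<and> (\<forall>\<mu> K. bounded_complex_measure \<mu> K \<longrightarrow>
       norm (complex_measure_integral \<mu> f - (\<Sum>\<alpha>\<in>P n. c n \<alpha> * \<mu> \<alpha>)) \<le> 4 * K / real (Suc n))"
    unfolding choice_iff by (elim exE)
  then show ?thesis
    by (intro that[of P c]) simp_all
qed

lemma tendsto_if_error_le_inverse_Suc: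
  fixes X :: "nat \<Rightarrow> 'b::real_normed_vector"
  assumes "\<And>n. norm (L - X n) \<le> C / real (Suc n)"
  shows "X \<longlonglongrightarrow> L"
proof -
  have "(\<lambda>n. C * inverse (real (Suc n))) \<longlonglongrightarrow> C * 0"
    by (intro tendsto_mult tendsto_const LIMSEQ_inverse_real_of_nat)
  then have "(\<lambda>n. C / real (Suc n)) \<longlonglongrightarrow> 0"
    by (simp only: divide_inverse mult_zero_right)
  moreover have "\<forall>\<^sub>F n in sequentially. norm (X n - L) \<le> C / real (Suc n)"
    using assms by (intro always_eventually allI) (metis norm_minus_commute)
  ultimately have "(\<lambda>n. X n - L) \<longlonglongrightarrow> 0"
    by (rule Lim_null_comparison[rotated])
  then show ?thesis
    by (rule LIM_zero_cancel)
qed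

lemma complex_measure_integral_diff:
  assumes f: "f \<in> borel_measurable borel" "\<And>x. norm (f x) \<le> B"
    and \<mu>: "bounded_complex_measure \<mu> K" and \<nu>: "bounded_complex_measure \<nu> L"
  shows "complex_measure_integral (\<lambda>\<alpha>. \<mu> \<alpha> - \<nu> \<alpha>) f
           = complex_measure_integral \<mu> f - complex_measure_integral \<nu> f"
proof -
  obtain P c where "\<And>n. P n \<subseteq> sets borel"
    and est: "\<And>\<mu> K n. bounded_complex_measure \<mu> K \<Longrightarrow>
       norm (complex_measure_integral \<mu> f - (\<Sum>\<alpha>\<in>P n. c n \<alpha> * \<mu> \<alpha>)) \<le> 4 * K / real (Suc n)"
    using riemann_sums[OF f] by metis
  have lim: "(\<lambda>n. \<Sum>\<alpha>\<in>P n. c n \<alpha> * \<mu> \<alpha>) \<longlonglongrightarrow> complex_measure_integral \<mu> f"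
    if "bounded_complex_measure \<mu> K" for \<mu> K
    by (rule tendsto_if_error_le_inverse_Suc) (rule est[OF that])
  have "bounded_complex_measure (\<lambda>\<alpha>. \<mu> \<alpha> - \<nu> \<alpha>) (K + L)"
    using \<mu> \<nu> unfolding bounded_complex_measure_def by (rule bounded_vector_measure_diff)
  from lim[OF this] have "(\<lambda>n. (\<Sum>\<alpha>\<in>P n. c n \<alpha> * \<mu> \<alpha>) - (\<Sum>\<alpha>\<in>P n. c n \<alpha> * \<nu> \<alpha>))
      \<longlonglongrightarrow> complex_measure_integral (\<lambda>\<alpha>. \<mu> \<alpha> - \<nu> \<alpha>) f"
    by (simp add: right_diff_distrib sum_subtractf)
  from LIMSEQ_unique[OF this tendsto_diff[OF lim[OF \<mu>] lim[OF \<nu>]]] show ?thesis .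
qed

section \<open>Inner products and positive operators\<close>

text \<open>
  In a complex space a sesquilinear form with real diagonal is automatically Hermitian, by
  polarization at \<open>x + y\<close> and \<open>x + \<i> y\<close>.  Both the inner product and the form of a positive
  operator are instances.
\<close>

lemma sesquilinear_cauchy_schwarz:
  fixes B :: "'h::complex_vector \<Rightarrow> 'h \<Rightarrow> complex"
  assumes add: "\<And>x y z. B (x + y) z = B x z + B y z" "\<And>x y z. B x (y + z) = B x y + B x z"
    and scale: "\<And>c x y. B (c *\<^sub>C x) y = c * B x y" "\<And>c x y. B x (c *\<^sub>C y) = cnj c * B x y"
    and pos: "\<And>x. B x x \<in> \<real>\<^sub>\<ge>\<^sub>0"
  shows "(cmod (B x y))\<^sup>2 \<le> Re (B x x) * Re (B y y)"
proof -
  have real: "Im (B z z) = 0" "0 \<le> Re (B z z)" for z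
    using pos[of z] by (auto simp: complex_nonneg_Reals_iff)
  have herm: "B y x = cnj (B x y)"
    using real(1)[of "x + y"] real(1)[of "x + \<i> *\<^sub>C y"] real(1)[of x] real(1)[of y]
    by (simp add: add scale complex_eq_iff)
  define s where "s = (cmod (B x y))\<^sup>2"
  have s: "s = (Re (B x y))\<^sup>2 + (Im (B x y))\<^sup>2"
    by (simp add: s_def cmod_power2)
  \<comment> \<open>the form at \<open>x - t B(x,y) y\<close>, a quadratic polynomial in the real number \<open>t\<close>\<close>
  have quadratic: "0 \<le> Re (B x x) - 2 * t * s + t\<^sup>2 * s * Re (B y y)" for t :: real
  proof -
    define c where "c = - of_real t * B x y"
    have "B (x + c *\<^sub>C y) (x + c *\<^sub>C y) = B x x + cnj c * B x y + c * cnj (B x y) + c * cnj c * B y y"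
      by (simp add: add scale herm algebra_simps)
    also have "Re \<dots> = Re (B x x) - 2 * t * s + t\<^sup>2 * s * Re (B y y)"
      using real(1)[of y] by (simp add: c_def s algebra_simps power2_eq_square)
    finally show ?thesis
      using real(2)[of "x + c *\<^sub>C y"] by simp
  qed
  have "s \<le> Re (B x x) * Re (B y y)"
  proof (cases "Re (B y y) = 0")
    case True
    have "s = 0"
    proof (rule ccontr)
      assume "s \<noteq> 0"
      then have "0 < s" by (simp add: s_def)
      then have e: "2 * ((Re (B x x) + 1) / s) * s = 2 * (Re (B x x) + 1)"
        by simp
      show False
        using quadratic[of "(Re (B x x) + 1) / s"] real(2)[of x] unfolding e True by simp
    qed
    with True show ?thesis by simp
  next
    case False
    then have "0 < Re (B y y)"
      using real(2)[of y] by simp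
    with quadratic[of "1 / Re (B y y)"] show ?thesis
      by (simp add: field_simps power2_eq_square)
  qed
  then show ?thesis by (simp add: s_def)
qed

lemma cinner_add_right: "cinner x (y + z) = cinner x y + cinner x z"
  using cinner_add_left[of y z x] by (metis cinner_commute complex_cnj_add)

lemma cinner_scaleC_right: "cinner x (c *\<^sub>C y) = cnj c * cinner x y"
  using cinner_scaleC_left[of c y x] by (metis cinner_commute complex_cnj_mult)

lemma cinner_self_nonneg: "cinner x x \<in> \<real>\<^sub>\<ge>\<^sub>0"
proof -
  have "Im (cinner x x) = Im (cnj (cinner x x))"
    using cinner_commute[of x x] by simp
  then show ?thesis
    using cinner_ge_zero[of x] by (simp add: complex_nonneg_Reals_iff)
qed

lemma Re_cinner_self: "Re (cinner x x) = (norm x)\<^sup>2"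
  by (simp add: norm_eq_sqrt_cinner cinner_ge_zero)

lemma norm_cinner_le: "cmod (cinner x y) \<le> norm x * norm y"
proof -
  have "(cmod (cinner x y))\<^sup>2 \<le> (norm x * norm y)\<^sup>2"
    using sesquilinear_cauchy_schwarz[of cinner x y]
    by (simp add: cinner_add_left cinner_add_right cinner_scaleC_left cinner_scaleC_right
        cinner_self_nonneg Re_cinner_self power_mult_distrib)
  then show ?thesis
    by (rule power2_le_imp_le) simp
qed

lemma bounded_bilinear_cinner: "bounded_bilinear (cinner :: 'h::complex_inner \<Rightarrow> 'h \<Rightarrow> complex)"
proof
  show "\<exists>K. \<forall>x y :: 'h. norm (cinner x y) \<le> norm x * norm y * K"
    using norm_cinner_le by (intro exI[of _ 1]) auto
qed (simp_all add: cinner_add_left cinner_add_right scaleR_scaleC cinner_scaleC_left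
      cinner_scaleC_right scaleR_conv_of_real)

interpretation cinner: bounded_bilinear "cinner :: 'h::complex_inner \<Rightarrow> 'h \<Rightarrow> complex"
  by (rule bounded_bilinear_cinner)

lemma norm_scaleC: "norm (c *\<^sub>C (x :: 'h::complex_inner)) = cmod c * norm x"
proof -
  have "cinner (c *\<^sub>C x) (c *\<^sub>C x) = of_real ((cmod c)\<^sup>2) * cinner x x"
    unfolding complex_norm_square by (simp add: cinner_scaleC_left cinner_scaleC_right mult.assoc)
  then have "(norm (c *\<^sub>C x))\<^sup>2 = (cmod c * norm x)\<^sup>2"
    by (simp add: power_mult_distrib flip: Re_cinner_self)
  then show ?thesis
    by (rule power2_eq_imp_eq) simp_all
qed

lemma bounded_linear_scaleC: "bounded_linear (\<lambda>x :: 'h::complex_inner. c *\<^sub>C x)"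
  by (rule bounded_linear_intro[where K = "cmod c"])
    (simp_all add: scaleC_add_right scaleR_scaleC scaleC_scaleC norm_scaleC mult.commute)

lemma norm_le_if_cinner_le:
  fixes x :: "'h::complex_inner"
  assumes "\<And>y. cmod (cinner x y) \<le> C * norm y" "0 \<le> C"
  shows "norm x \<le> C"
proof (cases "x = 0")
  case False
  have "(norm x)\<^sup>2 \<le> C * norm x"
    using assms(1)[of x] abs_Re_le_cmod[of "cinner x x"] by (simp flip: Re_cinner_self)
  with False show ?thesis
    by (simp add: power2_eq_square)
qed (simp add: assms(2))

lemma eq_if_cinner_eq:
  fixes x y :: "'h::complex_inner"
  assumes "\<And>z. cinner x z = cinner y z"
  shows "x = y"
  using assms[of "x - y"] cinner_eq_zero_iff[of "x - y"] by (simp add: cinner.diff_left)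

section \<open>The completely positive map of a quantum probability measure\<close>

lemma quantum_prob_measures_D:
  assumes "E \<in> quantum_prob_measures"
  shows "\<And>\<delta>. \<delta> \<in> sets borel \<Longrightarrow> positive_op (E \<delta>)" "E UNIV = id_blinfun"
    "vector_measure (\<lambda>\<alpha>. E \<alpha> \<xi>)"
  using assms unfolding quantum_prob_measures_def vector_measure_def by auto

text \<open>
  The Cauchy-Schwarz inequality for the positive form of \<open>E \<alpha>\<close>, together with \<open>E \<alpha> \<le> I\<close>, which
  holds as \<open>E\<close> is also positive on the complement of \<open>\<alpha>\<close>.
\<close>

lemma bounded_complex_measure_qmeasure:
  fixes E :: "'a::topological_space set \<Rightarrow> ('h::complex_hilbert \<Rightarrow>\<^sub>L 'h)"
  assumes E: "E \<in> quantum_prob_measures"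
  shows "bounded_complex_measure (qmeasure E \<xi> \<eta>) (norm \<xi> * norm \<eta>)"
proof
  interpret vector_measure "\<lambda>\<alpha>. E \<alpha> \<xi>" for \<xi>
    by (rule quantum_prob_measures_D(3)[OF E])
  show "(\<lambda>n::nat. qmeasure E \<xi> \<eta> (D n)) sums qmeasure E \<xi> \<eta> (\<Union>n. D n)"
    if "range D \<subseteq> sets borel" "disjoint_family D" for D
    unfolding qmeasure_def by (rule bounded_linear.sums[OF cinner.bounded_linear_left sums_UN[OF that]])
  fix \<alpha> :: "'a set"
  assume \<alpha>: "\<alpha> \<in> sets borel"
  have lin: "E \<alpha> (c *\<^sub>C x) = c *\<^sub>C E \<alpha> x" for c x
    using quantum_prob_measures_D(1)[OF E \<alpha>] by (simp add: positive_op_def bounded_ops_def)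
  have pos: "cinner (E \<beta> x) x \<in> \<real>\<^sub>\<ge>\<^sub>0" if "\<beta> \<in> sets borel" for \<beta> x
    using quantum_prob_measures_D(1)[OF E that] by (simp add: positive_op_def)
  have below_id: "Re (cinner (E \<alpha> x) x) \<le> (norm x)\<^sup>2" for x
  proof -
    have "E (- \<alpha>) x = x - E \<alpha> x"
      using Diff[of UNIV \<alpha> x] \<alpha> quantum_prob_measures_D(2)[OF E] by (simp add: Compl_eq_Diff_UNIV)
    moreover have "0 \<le> Re (cinner (E (- \<alpha>) x) x)"
      using pos[of "- \<alpha>" x] \<alpha> by (simp add: complex_nonneg_Reals_iff borel_comp)
    ultimately show ?thesis
      by (simp add: cinner.diff_left Re_cinner_self)
  qed
  have "(cmod (cinner (E \<alpha> \<xi>) \<eta>))\<^sup>2 \<le> Re (cinner (E \<alpha> \<xi>) \<xi>) * Re (cinner (E \<alpha> \<eta>) \<eta>)"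
    by (rule sesquilinear_cauchy_schwarz)
      (simp_all add: blinfun.add_right cinner_add_left cinner_add_right lin cinner_scaleC_left
        cinner_scaleC_right pos[OF \<alpha>])
  also have "\<dots> \<le> (norm \<xi>)\<^sup>2 * (norm \<eta>)\<^sup>2"
    using pos[OF \<alpha>] by (intro mult_mono below_id) (auto simp: complex_nonneg_Reals_iff)
  finally have "(cmod (cinner (E \<alpha> \<xi>) \<eta>))\<^sup>2 \<le> (norm \<xi> * norm \<eta>)\<^sup>2"
    by (simp add: power_mult_distrib)
  then show "norm (qmeasure E \<xi> \<eta> \<alpha>) \<le> norm \<xi> * norm \<eta>"
    unfolding qmeasure_def by (rule power2_le_imp_le) simp
qed

lemma bcontfun_measurable: "apply_bcontfun f \<in> borel_measurable borel"
  by (intro borel_measurable_continuous_onI continuous_on_apply_bcontfun)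

text \<open>
  The operators \<open>\<Sum>c\<^sub>\<alpha> E(\<alpha>)\<close> belonging to a sequence of Riemann sums converge at each vector, since
  the error of the Riemann sums for \<open>qmeasure E \<xi> \<eta>\<close> is uniform over all unit vectors \<open>\<eta>\<close>.  The
  limit operator is linear because its approximants are.
\<close>

lemma phi_exists:
  fixes E :: "'a::topological_space set \<Rightarrow> ('h::complex_hilbert \<Rightarrow>\<^sub>L 'h)"
  assumes E: "E \<in> quantum_prob_measures"
  shows "\<exists>T \<in> bounded_ops. \<forall>\<xi> \<eta>. cinner (T \<xi>) \<eta> = complex_measure_integral (qmeasure E \<xi> \<eta>) (apply_bcontfun f)"
proof -
  define I where "I \<xi> \<eta> = complex_measure_integral (qmeasure E \<xi> \<eta>) (apply_bcontfun f)" for \<xi> \<eta>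
  obtain P c where P: "\<And>n. P n \<subseteq> sets borel"
    and est: "\<And>\<mu> K n. bounded_complex_measure \<mu> K \<Longrightarrow>
       norm (complex_measure_integral \<mu> (apply_bcontfun f) - (\<Sum>\<alpha>\<in>P n. c n \<alpha> * \<mu> \<alpha>)) \<le> 4 * K / real (Suc n)"
    using riemann_sums[OF bcontfun_measurable norm_bounded] by metis
  define v where "v \<xi> n = (\<Sum>\<alpha>\<in>P n. c n \<alpha> *\<^sub>C E \<alpha> \<xi>)" for \<xi> n
  have v_add: "v (\<xi> + \<eta>) n = v \<xi> n + v \<eta> n" for \<xi> \<eta> n
    by (simp add: v_def blinfun.add_right scaleC_add_right sum.distrib)
  have v_scale: "v (a *\<^sub>C \<xi>) n = a *\<^sub>C v \<xi> n" for a \<xi> n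
  proof -
    have "c n \<alpha> *\<^sub>C E \<alpha> (a *\<^sub>C \<xi>) = a *\<^sub>C c n \<alpha> *\<^sub>C E \<alpha> \<xi>" if "\<alpha> \<in> P n" for \<alpha>
      using quantum_prob_measures_D(1)[OF E, of \<alpha>] P[of n] that
      by (auto simp: positive_op_def bounded_ops_def scaleC_scaleC mult.commute)
    then show ?thesis
      by (simp add: v_def bounded_linear.linear[OF bounded_linear_scaleC] linear_sum)
  qed
  have approx: "cmod (I \<xi> \<eta> - cinner (v \<xi> n) \<eta>) \<le> 4 * (norm \<xi> * norm \<eta>) / real (Suc n)" for \<xi> \<eta> n
    using est[OF bounded_complex_measure_qmeasure[OF E], of \<xi> \<eta> n]
    by (simp add: I_def v_def cinner.sum_left cinner_scaleC_left qmeasure_def)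
  have Cauchy: "Cauchy (v \<xi>)" for \<xi>
  proof (rule metric_CauchyI)
    fix e :: real
    assume "0 < e"
    have "(\<lambda>n. 8 * norm \<xi> * inverse (real (Suc n))) \<longlonglongrightarrow> 8 * norm \<xi> * 0"
      by (intro tendsto_mult tendsto_const LIMSEQ_inverse_real_of_nat)
    then obtain N where N: "8 * norm \<xi> * inverse (real (Suc N)) < e"
      using order_tendstoD(2)[of _ 0 sequentially e] \<open>0 < e\<close> eventually_happens'[OF sequentially_bot]
      by (metis (no_types, lifting) mult_zero_right)
    have "dist (v \<xi> m) (v \<xi> n) < e" if "N \<le> m" "N \<le> n" for m n
    proof -
      have "cmod (cinner (v \<xi> m - v \<xi> n) \<eta>) \<le> 8 * norm \<xi> * inverse (real (Suc N)) * norm \<eta>" for \<eta>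
      proof -
        have "4 * (norm \<xi> * norm \<eta>) / real (Suc k) \<le> 4 * (norm \<xi> * norm \<eta>) / real (Suc N)" if "N \<le> k" for k
          using that by (intro divide_left_mono) auto
        from this[OF \<open>N \<le> m\<close>] this[OF \<open>N \<le> n\<close>]
        have "cmod (I \<xi> \<eta> - cinner (v \<xi> m) \<eta>) \<le> 4 * (norm \<xi> * norm \<eta>) / real (Suc N)"
          "cmod (I \<xi> \<eta> - cinner (v \<xi> n) \<eta>) \<le> 4 * (norm \<xi> * norm \<eta>) / real (Suc N)"
          using approx order_trans by blast+
        moreover have "cmod (cinner (v \<xi> m - v \<xi> n) \<eta>)
            \<le> cmod (I \<xi> \<eta> - cinner (v \<xi> n) \<eta>) + cmod (I \<xi> \<eta> - cinner (v \<xi> m) \<eta>)"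
          using norm_triangle_ineq4[of "I \<xi> \<eta> - cinner (v \<xi> n) \<eta>" "I \<xi> \<eta> - cinner (v \<xi> m) \<eta>"]
          by (simp add: cinner.diff_left)
        moreover have "8 * norm \<xi> * inverse (real (Suc N)) * norm \<eta>
            = 2 * (4 * (norm \<xi> * norm \<eta>) / real (Suc N))"
          by (simp add: divide_inverse)
        ultimately show ?thesis
          by linarith
      qed
      then have "norm (v \<xi> m - v \<xi> n) \<le> 8 * norm \<xi> * inverse (real (Suc N))"
        by (rule norm_le_if_cinner_le) simp
      with N show ?thesis
        by (simp add: dist_norm)
    qed
    then show "\<exists>N. \<forall>m\<ge>N. \<forall>n\<ge>N. dist (v \<xi> m) (v \<xi> n) < e"
      by blast
  qed
  define T where "T \<xi> = lim (v \<xi>)" for \<xi>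
  have lim: "v \<xi> \<longlonglongrightarrow> T \<xi>" for \<xi>
    using Cauchy_convergent[OF Cauchy] by (simp add: T_def convergent_LIMSEQ_iff)
  have T_cinner: "cinner (T \<xi>) \<eta> = I \<xi> \<eta>" for \<xi> \<eta>
  proof (rule LIMSEQ_unique)
    show "(\<lambda>n. cinner (v \<xi> n) \<eta>) \<longlonglongrightarrow> cinner (T \<xi>) \<eta>"
      by (intro cinner.tendsto lim tendsto_const)
    show "(\<lambda>n. cinner (v \<xi> n) \<eta>) \<longlonglongrightarrow> I \<xi> \<eta>"
      by (rule tendsto_if_error_le_inverse_Suc) (rule approx)
  qed
  have T_add: "T (\<xi> + \<eta>) = T \<xi> + T \<eta>" for \<xi> \<eta>
  proof (rule LIMSEQ_unique[OF lim])
    have "v (\<xi> + \<eta>) = (\<lambda>n. v \<xi> n + v \<eta> n)"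
      by (rule ext) (rule v_add)
    then show "v (\<xi> + \<eta>) \<longlonglongrightarrow> T \<xi> + T \<eta>"
      by (simp only:) (intro tendsto_add lim)
  qed
  have T_scale: "T (a *\<^sub>C \<xi>) = a *\<^sub>C T \<xi>" for a \<xi>
  proof (rule LIMSEQ_unique[OF lim])
    have "v (a *\<^sub>C \<xi>) = (\<lambda>n. a *\<^sub>C v \<xi> n)"
      by (rule ext) (rule v_scale)
    then show "v (a *\<^sub>C \<xi>) \<longlonglongrightarrow> a *\<^sub>C T \<xi>"
      by (simp only:) (rule bounded_linear.tendsto[OF bounded_linear_scaleC lim])
  qed
  have T_bound: "norm (T \<xi>) \<le> norm \<xi> * (4 * norm f)" for \<xi>
  proof (rule norm_le_if_cinner_le)
    show "cmod (cinner (T \<xi>) \<eta>) \<le> norm \<xi> * (4 * norm f) * norm \<eta>" for \<eta>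
      using bounded_complex_measure.norm_integral_le[OF bounded_complex_measure_qmeasure[OF E]
          bcontfun_measurable norm_bounded, of \<xi> \<eta> f]
      by (simp add: T_cinner I_def mult_ac)
  qed simp
  have "bounded_linear T"
    by (rule bounded_linear_intro[OF T_add _ T_bound]) (simp add: scaleR_scaleC T_scale)
  then have "blinfun_apply (Blinfun T) = T"
    by (rule bounded_linear_Blinfun_apply)
  then show ?thesis
    by (intro bexI[of _ "Blinfun T"]) (simp_all add: bounded_ops_def T_scale T_cinner I_def)
qed

lemma cinner_phi:
  fixes E :: "'a::topological_space set \<Rightarrow> ('h::complex_hilbert \<Rightarrow>\<^sub>L 'h)"
  assumes "E \<in> quantum_prob_measures"
  shows "cinner (phi E f \<xi>) \<eta> = complex_measure_integral (qmeasure E \<xi> \<eta>) (apply_bcontfun f)"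
proof -
  let ?P = "\<lambda>T. T \<in> bounded_ops \<and>
     (\<forall>\<xi> \<eta>. cinner (blinfun_apply T \<xi>) \<eta> = complex_measure_integral (qmeasure E \<xi> \<eta>) (apply_bcontfun f))"
  obtain T where T: "?P T"
    using phi_exists[OF assms] by blast
  have "T' = T" if "?P T'" for T'
    using that T by (intro blinfun_eqI eq_if_cinner_eq) simp
  with T have "?P (phi E f)"
    unfolding phi_def by (rule theI)
  then show ?thesis by blast
qed

section \<open>The distance of two quantum probability measures\<close>

text \<open>
  The operators \<open>phi E f - phi F f\<close> have the matrix coefficients \<open>\<integral> f d\<mu>\<^sub>\<xi>\<^sub>\<eta>\<close>, where
  \<open>\<mu>\<^sub>\<xi>\<^sub>\<eta> = E\<^sub>\<xi>\<^sub>\<eta> - F\<^sub>\<xi>\<^sub>\<eta>\<close>; the two inequalities between integrals and total variation then give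
  the two inequalities between the suprema.
\<close>

theorem proposition2p3:
  fixes E F :: "'a::{second_countable_topology, t2_space} set \<Rightarrow> ('h::complex_hilbert \<Rightarrow>\<^sub>L 'h)"
  assumes "compact (UNIV :: 'a set)"
    and "separable_space (euclidean :: 'h topology)"
    and "E \<in> quantum_prob_measures"
    and "F \<in> quantum_prob_measures"
  shows "rho E F = ennreal (onorm (\<lambda>f. phi E f - phi F f))"
proof -
  define \<mu> where "\<mu> \<xi> \<eta> \<alpha> = qmeasure E \<xi> \<eta> \<alpha> - qmeasure F \<xi> \<eta> \<alpha>" for \<xi> \<eta> \<alpha>
  define D where "D f = phi E f - phi F f" for f
  have \<mu>: "bounded_complex_measure (\<mu> \<xi> \<eta>) (norm \<xi> * norm \<eta> + norm \<xi> * norm \<eta>)" for \<xi> \<eta>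
    unfolding \<mu>_def bounded_complex_measure_def
    by (intro bounded_vector_measure_diff bounded_complex_measure_qmeasure[unfolded bounded_complex_measure_def] assms)
  have D: "cinner (D f \<xi>) \<eta> = complex_measure_integral (\<mu> \<xi> \<eta>) (apply_bcontfun f)" for f \<xi> \<eta>
    unfolding D_def \<mu>_def blinfun.diff_left cinner.diff_left
      complex_measure_integral_diff[OF bcontfun_measurable norm_bounded
        bounded_complex_measure_qmeasure[OF assms(3)] bounded_complex_measure_qmeasure[OF assms(4)]]
    by (simp add: cinner_phi assms)
  have D_bound: "norm (D f) \<le> 8 * norm f" for f
  proof (intro norm_blinfun_bound norm_le_if_cinner_le)
    show "cmod (cinner (D f \<xi>) \<eta>) \<le> 8 * norm f * norm \<xi> * norm \<eta>" for \<xi> \<eta>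
      using bounded_complex_measure.norm_integral_le[OF \<mu> bcontfun_measurable norm_bounded, of \<xi> \<eta> f]
      by (simp add: D mult_ac)
  qed simp_all
  \<comment> \<open>\<open>onorm\<close> is a real supremum, which bounds its terms only once they are known to be bounded\<close>
  have bdd: "bdd_above (range (\<lambda>f. norm (D f) / norm f))"
  proof (rule bdd_aboveI2)
    show "norm (D f) / norm f \<le> 8" for f
      using D_bound[of f] by (cases "norm f = 0") (simp_all add: field_simps)
  qed
  have onorm_upper: "norm (D f) \<le> onorm D * norm f" for f
  proof (cases "f = 0")
    case True
    then show ?thesis using D_bound[of f] by simp
  next
    case False
    have "norm (D f) / norm f \<le> onorm D"
      unfolding onorm_def by (rule cSUP_upper[OF UNIV_I bdd])
    with False show ?thesis by (simp add: field_simps)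
  qed
  \<comment> \<open>the quotient at \<open>0\<close> is \<open>0 / 0 = 0\<close>\<close>
  have onorm_nonneg: "0 \<le> onorm D"
    unfolding onorm_def by (rule cSUP_upper2[OF bdd UNIV_I, of _ 0]) simp
  have le: "rho E F \<le> ennreal (onorm D)"
    unfolding rho_def
  proof (intro SUP_least, clarify)
    fix \<xi> \<eta> :: 'h
    assume unit: "norm \<xi> = 1" "norm \<eta> = 1"
    have "tv_norm (\<mu> \<xi> \<eta>) \<le> ennreal (onorm D)"
    proof (rule tv_norm_le_if_integrals_le[OF \<mu> assms(1)])
      fix f :: "'a \<Rightarrow> complex"
      assume f: "continuous_on UNIV f" "\<And>x. norm (f x) \<le> 1"
      have f_eq: "apply_bcontfun (Bcontfun f) = f"
        by (rule Bcontfun_inverse) (rule bcontfun_normI[OF f])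
      then have "norm (Bcontfun f) \<le> 1"
        using f(2) by (intro norm_bound) simp
      have "norm (complex_measure_integral (\<mu> \<xi> \<eta>) f) = cmod (cinner (D (Bcontfun f) \<xi>) \<eta>)"
        by (simp add: D f_eq)
      also have "\<dots> \<le> norm (D (Bcontfun f))"
        using norm_cinner_le[of "D (Bcontfun f) \<xi>" \<eta>] norm_blinfun[of "D (Bcontfun f)" \<xi>] unit
        by simp
      also have "\<dots> \<le> onorm D"
        using onorm_upper[of "Bcontfun f"] mult_left_mono[OF \<open>norm (Bcontfun f) \<le> 1\<close> onorm_nonneg]
        by simp
      finally show "norm (complex_measure_integral (\<mu> \<xi> \<eta>) f) \<le> onorm D" .
    qed
    then show "tv_norm (\<lambda>\<alpha>. qmeasure E \<xi> \<eta> \<alpha> - qmeasure F \<xi> \<eta> \<alpha>) \<le> ennreal (onorm D)"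
      by (simp add: \<mu>_def[abs_def])
  qed
  define r where "r = enn2real (rho E F)"
  have r: "0 \<le> r" "rho E F = ennreal r"
    using le_less_trans[OF le ennreal_less_top] by (simp_all add: r_def)
  have unit_bound: "cmod (cinner (D f \<xi>) \<eta>) \<le> norm f * r" if "norm \<xi> = 1" "norm \<eta> = 1" for f \<xi> \<eta>
  proof -
    have "tv_norm (\<mu> \<xi> \<eta>) \<le> rho E F"
      unfolding rho_def \<mu>_def[abs_def]
      by (rule SUP_upper2[of "(\<xi>, \<eta>)"]) (use that in simp_all)
    then have "ennreal (norm f) * tv_norm (\<mu> \<xi> \<eta>) \<le> ennreal (norm f * r)"
      using r by (simp add: ennreal_mult mult_left_mono)
    with bounded_complex_measure.norm_integral_le_tv_norm[OF \<mu> bcontfun_measurable norm_bounded, of \<xi> \<eta> f]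
    have "ennreal (cmod (cinner (D f \<xi>) \<eta>)) \<le> ennreal (norm f * r)"
      unfolding D by (rule order_trans)
    then show ?thesis
      using r(1) by simp
  qed
  have "norm (D f) \<le> norm f * r" for f
  proof (intro norm_blinfun_bound norm_le_if_cinner_le)
    show "cmod (cinner (D f \<xi>) \<eta>) \<le> norm f * r * norm \<xi> * norm \<eta>" for \<xi> \<eta>
    proof (cases "\<xi> = 0 \<or> \<eta> = 0")
      case True
      then show ?thesis by (auto simp: cinner.zero_left cinner.zero_right)
    next
      case False
      have "cinner (D f \<xi>) \<eta> = cinner (D f (norm \<xi> *\<^sub>R sgn \<xi>)) (norm \<eta> *\<^sub>R sgn \<eta>)"
        using False by (simp add: sgn_div_norm)
      also have "\<dots> = (norm \<xi> * norm \<eta>) *\<^sub>R cinner (D f (sgn \<xi>)) (sgn \<eta>)"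
        by (simp only: blinfun.scaleR_right cinner.scaleR_left cinner.scaleR_right scaleR_scaleR mult.commute)
      finally have "cmod (cinner (D f \<xi>) \<eta>) = norm \<xi> * norm \<eta> * cmod (cinner (D f (sgn \<xi>)) (sgn \<eta>))"
        by simp
      also have "\<dots> \<le> norm \<xi> * norm \<eta> * (norm f * r)"
        using False by (intro mult_left_mono unit_bound) (simp_all add: norm_sgn)
      finally show ?thesis
        by (simp add: mult_ac)
    qed
  qed (use r in simp_all)
  then have "norm (D f) / norm f \<le> r" for f
    using r(1) by (cases "norm f = 0") (simp_all add: field_simps)
  then have "onorm D \<le> r"
    unfolding onorm_def by (intro cSUP_least) simp_all
  then have "ennreal (onorm D) \<le> rho E F"
    using r(2) by (simp add: ennreal_leI)
  with le have "rho E F = ennreal (onorm D)"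
    by (rule antisym)
  then show ?thesis
    by (simp add: D_def[abs_def])
qed

end
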